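(* For the prevalent $f\in C[0,1]$ there is an open set $U_f\subset\mathbb{R}$ such that $\lambda(f^{-1}(U_f))=1$ (hence $U_f$ is dense in $f([0,1])$) and for all $y\in U_f$ we have $$\dim_H f^{-1}(y)=1.$$
   Context: Prevalence: for an abelian Polish group $G$, a set $A\subset G$ is shy if there exist a Borel set $B\supset A$ in $G$ and a Borel probability measure $\nu$ on $G$ with $\nu(B+x)=0$ for all $x\in G$; complements of shy sets are prevalent. "For the prevalent $f\in G$ property $P$ holds" means that $\{f\in G: P(f)\}$ is prevalent. $C[0,1]=C([0,1],\mathbb{R})$ is the Banach space of continuous real functions on $[0,1]$ with the maximum norm (an abelian Polish group under addition). $\lambda$ is one-dimensional Lebesgue measure; $\dim_H$ is Hausdorff dimension, with $\dim_H\emptyset=-1$. "$U_f$ is dense in $f([0,1])$" means that $U_f\cap f([0,1])$ is dense in $f([0,1])$. *)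

theory Defs
  imports "HOL-Probability.Probability"
begin

subsection \<open>Shy and prevalent sets in abelian Polish groups\<close>

text \<open>\<open>shy\<close> is what the literature calls Haar null; the witnessing measure may depend on the set.\<close>

definition shy :: "'a::{polish_space, topological_ab_group_add} set \<Rightarrow> bool" where
  "shy A \<longleftrightarrow> (\<exists>B \<nu>. B \<in> sets borel \<and> A \<subseteq> B \<and> sets \<nu> = sets borel \<and> prob_space \<nu> \<and>
     (\<forall>x. emeasure \<nu> ((\<lambda>b. b + x) ` B) = 0))"

definition prevalent :: "'a::{polish_space, topological_ab_group_add} set \<Rightarrow> bool" where
  "prevalent A \<longleftrightarrow> shy (- A)"


subsection \<open>Hausdorff measure and dimension\<close>

text \<open>
  \<open>diam_power s U\<close> is the \<open>s\<close>-th power of the diameter with the usual conventions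
  \<open>0\<^sup>0 = 1\<close> for nonempty \<open>U\<close> (whereas \<open>0 powr 0 = 0\<close>) and value \<open>0\<close> for empty \<open>U\<close>, so that
  the \<open>0\<close>-dimensional measure is counting measure.
\<close>

definition diam_power :: "real \<Rightarrow> 'a::metric_space set \<Rightarrow> ennreal" where
  "diam_power s U =
     (if U = {} then 0 else if s = 0 then 1 else ennreal (diameter U powr s))"

text \<open>The boundedness condition is needed because \<open>diameter\<close> is unspecified on unbounded sets.\<close>

definition hausdorff_premeasure :: "real \<Rightarrow> real \<Rightarrow> 'a::metric_space set \<Rightarrow> ennreal" where
  "hausdorff_premeasure s \<delta> A =
     (INF U \<in> {U :: nat \<Rightarrow> 'a set. A \<subseteq> (\<Union>i. U i) \<and> (\<forall>i. bounded (U i) \<and> diameter (U i) \<le> \<delta>)}.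
        \<Sum>i. diam_power s (U i))"

definition hausdorff_measure :: "real \<Rightarrow> 'a::metric_space set \<Rightarrow> ennreal" where
  "hausdorff_measure s A = (SUP \<delta> \<in> {0<..}. hausdorff_premeasure s \<delta> A)"

definition hausdorff_dim :: "'a::metric_space set \<Rightarrow> ereal" where
  "hausdorff_dim A =
     (if A = {} then -1 else Inf (ereal ` {s. 0 \<le> s \<and> hausdorff_measure s A = 0}))"


subsection \<open>The unit interval as a compact metric space\<close>

typedef unit_interval = "{0..1::real}"
  morphisms real_of_unit unit_of_real
  by (rule exI[of _ 0]) simp

instantiation unit_interval :: metric_space
begin

definition dist_unit_interval :: "unit_interval \<Rightarrow> unit_interval \<Rightarrow> real" where
  "dist_unit_interval x y = dist (real_of_unit x) (real_of_unit y)"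

definition uniformity_unit_interval :: "(unit_interval \<times> unit_interval) filter" where
  "uniformity_unit_interval = (INF e\<in>{0 <..}. principal {(x, y). dist x y < e})"

definition open_unit_interval :: "unit_interval set \<Rightarrow> bool" where
  "open_unit_interval U \<longleftrightarrow> (\<forall>x\<in>U. \<forall>\<^sub>F (x', y) in uniformity. x' = x \<longrightarrow> y \<in> U)"

instance
proof
  show "dist x y = 0 \<longleftrightarrow> x = y" for x y :: unit_interval
    by (simp add: dist_unit_interval_def real_of_unit_inject)
  show "dist x y \<le> dist x z + dist y z" for x y z :: unit_interval
    by (simp add: dist_unit_interval_def dist_triangle2)
qed (simp_all add: uniformity_unit_interval_def open_unit_interval_def)

end

class compact_metric_space = metric_space +
  assumes compact_UNIV: "compact UNIV"

instance unit_interval :: compact_metric_space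
proof
  have "continuous_on {0..1} unit_of_real"
    unfolding continuous_on_iff
    by (auto simp: dist_unit_interval_def unit_of_real_inverse)
  then have "compact (unit_of_real ` {0..1})"
    by (rule compact_continuous_image) simp
  also have "unit_of_real ` {0..1} = UNIV"
    using real_of_unit real_of_unit_inverse by (metis UNIV_eq_I image_eqI)
  finally show "compact (UNIV :: unit_interval set)" .
qed


subsection \<open>\<open>C(K)\<close> is an abelian Polish group\<close>

lemma countable_dense_imp_second_countable:
  fixes D :: "'a::metric_space set"
  assumes "countable D" and dense: "\<And>x e. e > 0 \<Longrightarrow> \<exists>d\<in>D. dist d x < e"
  shows "\<exists>B::'a set set. countable B \<and> open = generate_topology B"
proof -
  define B where "B = (\<lambda>(d, n). ball d (1 / real (Suc n))) ` (D \<times> UNIV)"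
  have "topological_basis B"
  proof (rule topological_basisI)
    show "open B'" if "B' \<in> B" for B'
      using that by (auto simp: B_def)
  next
    fix S and x :: 'a
    assume "open S" "x \<in> S"
    then obtain e where e: "e > 0" "ball x e \<subseteq> S"
      by (meson openE)
    obtain n where n: "1 / real (Suc n) < e / 2"
      using e(1) by (metis half_gt_zero nat_approx_posE)
    obtain d where d: "d \<in> D" "dist d x < 1 / real (Suc n)"
      using dense[of "1 / real (Suc n)" x] by auto
    have "ball d (1 / real (Suc n)) \<subseteq> ball x e"
    proof
      fix z assume "z \<in> ball d (1 / real (Suc n))"
      then have "dist d z < 1 / real (Suc n)" by simp
      with d n have "dist x z < e"
        using dist_triangle3[of x z d] by linarith
      then show "z \<in> ball x e" by simp
    qed
    with e d show "\<exists>B'\<in>B. x \<in> B' \<and> B' \<subseteq> S"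
      by (intro bexI[of _ "ball d (1 / real (Suc n))"]) (auto simp: B_def)
  qed
  moreover have "countable B"
    using assms(1) by (auto simp: B_def)
  ultimately show ?thesis
    using topological_basis_imp_subbasis by blast
qed

instance bcontfun :: (compact_metric_space, "{metric_space, second_countable_topology}")
  second_countable_topology
proof
  obtain Q :: "'b set" where Q: "countable Q" and
    Qd: "\<And>X. open X \<Longrightarrow> X \<noteq> {} \<Longrightarrow> \<exists>q\<in>Q. q \<in> X"
    using countable_dense_exists[where 'a='b] by metis
  have "\<forall>k::nat. \<exists>F::'a set. finite F \<and> UNIV \<subseteq> (\<Union>x\<in>F. ball x (1 / real (Suc k)))"
  proof
    fix k
    obtain F where "finite F" "F \<subseteq> UNIV" "UNIV \<subseteq> (\<Union>x\<in>F. ball x (1 / real (Suc k)) :: 'a set)"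
      by (rule compactE_image[OF compact_UNIV, of UNIV "\<lambda>x. ball x (1 / real (Suc k))"])
         auto
    then show "\<exists>F::'a set. finite F \<and> UNIV \<subseteq> (\<Union>x\<in>F. ball x (1 / real (Suc k)))"
      by blast
  qed
  then obtain F :: "nat \<Rightarrow> 'a set" where fin: "\<And>k. finite (F k)"
    and cov: "\<And>k. UNIV \<subseteq> (\<Union>x\<in>F k. ball x (1 / real (Suc k)))"
    by metis
  define P where "P = (\<lambda>(n::nat, k::nat, S) (g :: 'a \<Rightarrow>\<^sub>C 'b).
     (\<forall>x y. dist x y < 1 / real (Suc k) \<longrightarrow> dist (g x) (g y) < 1 / real (Suc n)) \<and>
     (\<forall>(d, q)\<in>S. dist (g d) q < 1 / real (Suc n)))"
  define I where
    "I = (UNIV :: nat set) \<times> (SIGMA k:UNIV. {S. finite S \<and> S \<subseteq> F k \<times> Q})"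
  have "countable {S. finite S \<and> S \<subseteq> F k \<times> Q}" for k
    by (intro countable_Collect_finite_subset countable_SIGMA countable_finite[OF fin] Q)
  then have cI: "countable I"
    unfolding I_def by (intro countable_SIGMA) auto
  define D where "D = (\<lambda>i. SOME g. P i g) ` I"
  have "\<exists>g\<in>D. dist g f < e" if e: "e > 0" for f :: "'a \<Rightarrow>\<^sub>C 'b" and e
  proof -
    obtain n where n: "1 / real (Suc n) < e / 5"
      using e by (metis divide_pos_pos nat_approx_posE zero_less_numeral)
    have "uniformly_continuous_on UNIV f"
      by (intro compact_uniformly_continuous compact_UNIV continuous_on_apply_bcontfun)
    then obtain r where "r > 0" and r: "\<And>x y. dist x y < r \<Longrightarrow> dist (f x) (f y) < 1 / real (Suc n)"
      unfolding uniformly_continuous_on_def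
      by (metis UNIV_I dist_commute of_nat_0_less_iff zero_less_Suc zero_less_divide_1_iff)
    then obtain k where k: "1 / real (Suc k) < r"
      by (metis nat_approx_posE)
    have "\<exists>q\<in>Q. dist (f d) q < 1 / real (Suc n)" for d
      using Qd[of "ball (f d) (1 / real (Suc n))"] by auto
    then obtain q where q: "\<And>d. q d \<in> Q" "\<And>d. dist (f d) (q d) < 1 / real (Suc n)"
      by metis
    define S where "S = (\<lambda>d. (d, q d)) ` F k"
    have "(n, k, S) \<in> I"
      using q(1) fin by (auto simp: I_def S_def)
    moreover have "P (n, k, S) f"
      using r k q(2) by (force simp: P_def S_def)
    ultimately obtain g where g: "g \<in> D" "P (n, k, S) g"
      unfolding D_def by (metis imageI someI)
    have "dist (g x) (f x) \<le> 4 * (1 / real (Suc n))" for x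
    proof -
      obtain d where d: "d \<in> F k" "dist d x < 1 / real (Suc k)"
        using subsetD[OF cov[of k] UNIV_I[of x]] by auto
      have "dist (g d) (g x) < 1 / real (Suc n)" "dist (g d) (q d) < 1 / real (Suc n)"
        using g(2) d by (auto simp: P_def S_def)
      moreover have "dist (f d) (f x) < 1 / real (Suc n)"
        using r d k by force
      moreover have "dist (f d) (q d) < 1 / real (Suc n)"
        by (rule q)
      ultimately show ?thesis
        using dist_triangle[of "g x" "f x" "g d"] dist_triangle[of "g d" "f x" "f d"]
          dist_triangle2[of "g d" "f d" "q d"] dist_commute[of "g x" "g d"] by linarith
    qed
    then have "dist g f \<le> 4 * (1 / real (Suc n))"
      by (rule dist_bound)
    with n e have "dist g f < e" by linarith
    with g show ?thesis by blast
  qed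
  then show "\<exists>B::('a \<Rightarrow>\<^sub>C 'b) set set. countable B \<and> open = generate_topology B"
    using cI by (intro countable_dense_imp_second_countable[of D]) (auto simp: D_def)
qed

instance bcontfun :: (compact_metric_space, polish_space) polish_space ..

instance bcontfun :: (topological_space, real_normed_vector) topological_ab_group_add ..

text \<open>
  Every continuous function on the compact unit interval is bounded, so the type below is all of
  \<open>C[0,1]\<close>; its norm is the maximum norm.
\<close>

type_synonym C01 = "unit_interval \<Rightarrow>\<^sub>C real"

definition preimage01 :: "C01 \<Rightarrow> real set \<Rightarrow> real set" where
  "preimage01 f V = real_of_unit ` (apply_bcontfun f -` V)"

end

theory Submission
  imports Defs "HOL-Real_Asymp.Real_Asymp"
begin

text \<open>
  Perturb an arbitrary \<open>F\<close> in \<open>C[0,1]\<close> by a random series \<open>W\<close> of the functions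
  \<open>cos (2\<^sup>m \<pi> t) / (m + 1)\<^sup>2\<close> and \<open>sin (2\<^sup>m \<pi> t) / (m + 1)\<^sup>2\<close> with independent standard normal
  coefficients. Increments of \<open>W\<close> over distance \<open>2\<^sup>-\<^sup>m\<close> have variance at least of order
  \<open>m\<^sup>-\<^sup>4\<close>, so, whatever \<open>F\<close> is, the Fourier transform \<open>\<integral>\<^sub>I exp (\<i> \<xi> (F + W)(t)) dt\<close> of the occupation
  measure of an interval \<open>I\<close> is in mean smaller than every power of \<open>1 / \<bar>\<xi>\<bar>\<close>. Hence almost surely,
  for all dyadic intervals of length \<open>2\<^sup>-\<^sup>n\<close>, its \<open>L\<^sup>1\<close> norm is at most \<open>2\<^sup>-\<^sup>n\<close> times a
  polynomial in \<open>n\<close>.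

  By Fourier inversion the occupation measure then has a continuous density, the local time \<open>p\<close>.
  The set \<open>{p > 0}\<close> is open, and the occupation measure of its complement vanishes. For \<open>p y > 0\<close>
  the local time at \<open>y\<close> of dyadic intervals is a mass distribution on the fibre over \<open>y\<close> whose
  masses are bounded by the \<open>L\<^sup>1\<close> norms, so the fibre has dimension \<open>1\<close>.
\<close>

section \<open>Mollified occupation measures and local times\<close>

definition gauss_kernel :: "real \<Rightarrow> real \<Rightarrow> real" where
  "gauss_kernel a x = a * exp (- (a * x)\<^sup>2 / 2)"

lemma integrable_std_normal_scaled:
  assumes "a > 0"
  shows "integrable lborel (\<lambda>\<xi>. std_normal_density (\<xi> / a))"
  using lborel_integrable_real_affine_iff[of "1 / a" std_normal_density 0] assms
    integrable_normal_density[of 1 0]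
  by simp

lemma gauss_kernel_eq_Fourier:
  assumes "a > 0"
  shows "(CLBINT \<xi>. of_real (std_normal_density (\<xi> / a)) * iexp (\<xi> * x)) = of_real (gauss_kernel a x)"
proof -
  have "(CLBINT z. of_real (std_normal_density z) * iexp (z * (a * x))) = char std_normal_distribution (a * x)"
    unfolding char_def
    by (subst integral_density) (auto simp: scaleR_conv_of_real mult_ac)
  also have "\<dots> = of_real (exp (- (a * x)\<^sup>2 / 2))"
    by (simp add: char_std_normal_distribution)
  finally have "(CLBINT z. of_real (std_normal_density z) * iexp (z * (a * x))) = of_real (exp (- (a * x)\<^sup>2 / 2))" .
  then show ?thesis
    using assms lborel_integral_real_affine[of a "\<lambda>\<xi>. of_real (std_normal_density (\<xi> / a)) * iexp (\<xi> * x)" 0]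
    by (simp add: gauss_kernel_def mult_ac scaleR_conv_of_real)
qed

definition osc :: "real measure \<Rightarrow> (real \<Rightarrow> real) \<Rightarrow> real \<Rightarrow> complex" where
  "osc N g \<xi> = (CLINT t|N. iexp (\<xi> * g t))"

lemma norm_osc_le:
  assumes "finite_measure N"
  shows "norm (osc N g \<xi>) \<le> measure N (space N)"
proof -
  interpret finite_measure N by fact
  have "norm (osc N g \<xi>) \<le> (LINT t|N. 1)"
    unfolding osc_def using integral_norm_bound[of N "\<lambda>t. iexp (\<xi> * g t)"] by simp
  then show ?thesis by simp
qed

lemma osc_measurable [measurable]:
  assumes [simp]: "finite_measure N" and [measurable_cong]: "sets N = sets borel" and [measurable]: "g \<in> borel_measurable borel"
  shows "osc N g \<in> borel_measurable borel"
proof -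
  interpret finite_measure N by fact
  show ?thesis unfolding osc_def[abs_def] by measurable
qed

lemma mollified_occupation_eq_Fourier:
  assumes "finite_measure N" and sN[measurable_cong]: "sets N = sets borel"
    and [measurable]: "g \<in> borel_measurable borel" and a: "a > 0"
  shows "of_real (LINT t|N. gauss_kernel a (g t - y)) =
    (CLBINT \<xi>. of_real (std_normal_density (\<xi> / a)) * iexp (- (\<xi> * y)) * osc N g \<xi>)"
proof -
  interpret N: finite_measure N by fact
  interpret P: pair_sigma_finite N lborel ..
  let ?h = "\<lambda>t \<xi>. of_real (std_normal_density (\<xi> / a)) * iexp (\<xi> * (g t - y)) :: complex"
  have int: "integrable (N \<Otimes>\<^sub>M lborel) (\<lambda>(t, \<xi>). ?h t \<xi>)"
  proof (rule P.Fubini_integrable)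
    show "(\<lambda>(t, \<xi>). ?h t \<xi>) \<in> borel_measurable (N \<Otimes>\<^sub>M lborel)" by measurable
    show "integrable N (\<lambda>t. LINT \<xi>|lborel. norm (case (t, \<xi>) of (t, \<xi>) \<Rightarrow> ?h t \<xi>))"
      by (simp add: norm_mult)
    show "AE t in N. integrable lborel (\<lambda>\<xi>. case (t, \<xi>) of (t, \<xi>) \<Rightarrow> ?h t \<xi>)"
    proof (rule AE_I2)
      fix t
      have "integrable lborel (?h t)"
        by (rule Bochner_Integration.integrable_bound[OF integrable_std_normal_scaled[OF a]]) (auto simp: norm_mult)
      then show "integrable lborel (\<lambda>\<xi>. case (t, \<xi>) of (t, \<xi>) \<Rightarrow> ?h t \<xi>)" by simp
    qed
  qed
  have "of_real (LINT t|N. gauss_kernel a (g t - y)) = (CLINT t|N. (CLBINT \<xi>. ?h t \<xi>))"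
    by (simp only: gauss_kernel_eq_Fourier[OF a] integral_complex_of_real)
  also have "\<dots> = (CLBINT \<xi>. (CLINT t|N. ?h t \<xi>))"
    using P.Fubini_integral[OF int] by simp
  also have "\<dots> = (CLBINT \<xi>. of_real (std_normal_density (\<xi> / a)) * iexp (- (\<xi> * y)) * osc N g \<xi>)"
  proof (intro Bochner_Integration.integral_cong refl)
    fix \<xi>
    have "?h t \<xi> = of_real (std_normal_density (\<xi> / a)) * iexp (- (\<xi> * y)) * iexp (\<xi> * g t)" for t
      by (simp add: algebra_simps exp_add[symmetric])
    then show "(CLINT t|N. ?h t \<xi>) = of_real (std_normal_density (\<xi> / a)) * iexp (- (\<xi> * y)) * osc N g \<xi>"
      unfolding osc_def by (simp only: integral_mult_right_zero)
  qed
  finally show ?thesis .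
qed

definition mollified_occupation :: "real measure \<Rightarrow> (real \<Rightarrow> real) \<Rightarrow> real \<Rightarrow> real \<Rightarrow> real" where
  "mollified_occupation N g a y = (LINT t|N. gauss_kernel a (g t - y))"

definition local_time :: "real measure \<Rightarrow> (real \<Rightarrow> real) \<Rightarrow> real \<Rightarrow> real" where
  "local_time N g y = Re (CLBINT \<xi>. of_real (std_normal_density 0) * iexp (- (\<xi> * y)) * osc N g \<xi>)"

lemma gauss_kernel_nonneg [simp]: "a > 0 \<Longrightarrow> gauss_kernel a x \<ge> 0"
  by (simp add: gauss_kernel_def)

lemma gauss_kernel_le: "a > 0 \<Longrightarrow> gauss_kernel a x \<le> a"
  by (simp add: gauss_kernel_def)

lemma gauss_kernel_measurable [measurable]: "gauss_kernel a \<in> borel_measurable borel"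
  unfolding gauss_kernel_def[abs_def] by measurable

lemma mollified_occupation_nonneg [simp]: "a > 0 \<Longrightarrow> mollified_occupation N g a y \<ge> 0"
  by (simp add: mollified_occupation_def)

lemma std_normal_density_le: "std_normal_density x \<le> std_normal_density 0"
  by (simp add: std_normal_density_def divide_right_mono)

lemma std_normal_density_le_1: "std_normal_density x \<le> 1"
proof -
  have "1 \<le> sqrt (2 * pi)"
    using pi_ge_two by simp
  then have "std_normal_density 0 \<le> 1"
    by (simp add: std_normal_density_def)
  then show ?thesis
    using std_normal_density_le[of x] by linarith
qed

lemma gauss_kernel_integral_ge_1:
  assumes "a > 0" "ball x (1 / a) \<subseteq> S" "S \<in> sets borel"
  shows "1 \<le> (\<integral>\<^sup>+y. ennreal (gauss_kernel a (x - y)) * indicator S y \<partial>lborel)"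
proof -
  have "ennreal 1 \<le> ennreal (a * exp (-1/2) * (2 / a))"
  proof (rule ennreal_leI)
    have "1 / 2 \<le> exp (- 1 / 2 :: real)"
      using exp_ge_add_one_self[of "- 1 / 2"] by simp
    then show "1 \<le> a * exp (- 1 / 2) * (2 / a)" using assms(1) by simp
  qed
  also have "\<dots> = (\<integral>\<^sup>+y. ennreal (a * exp (-1/2)) * indicator {x - 1 / a<..<x + 1 / a} y \<partial>lborel)"
    using assms(1) by (subst nn_integral_cmult_indicator) (auto simp: ennreal_mult'[symmetric])
  also have "\<dots> \<le> (\<integral>\<^sup>+y. ennreal (gauss_kernel a (x - y)) * indicator S y \<partial>lborel)"
  proof (rule nn_integral_mono)
    fix y
    show "ennreal (a * exp (-1/2)) * indicator {x - 1 / a<..<x + 1 / a} y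
       \<le> ennreal (gauss_kernel a (x - y)) * indicator S y"
    proof (cases "y \<in> {x - 1 / a<..<x + 1 / a}")
      case True
      then have "\<bar>x - y\<bar> < 1 / a" by auto
      then have "a * \<bar>x - y\<bar> < 1"
        using assms(1) by (simp add: field_simps)
      moreover have "\<bar>a * (x - y)\<bar> = a * \<bar>x - y\<bar>"
        using assms(1) by (simp add: abs_mult)
      ultimately have "\<bar>a * (x - y)\<bar> \<le> 1"
        by linarith
      then have "(a * (x - y))\<^sup>2 \<le> 1"
        by (simp add: abs_square_le_1)
      moreover have "y \<in> S"
        using assms(2) \<open>\<bar>x - y\<bar> < 1 / a\<close> by (auto simp: dist_real_def)
      ultimately show ?thesis
        using assms(1) True by (auto simp: gauss_kernel_def intro!: ennreal_leI mult_left_mono)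
    qed auto
  qed
  finally show ?thesis by simp
qed

locale integrable_osc = finite_measure N for N :: "real measure" +
  fixes g :: "real \<Rightarrow> real"
  assumes sets_N [measurable_cong, simp]: "sets N = sets borel"
    and g_measurable [measurable]: "g \<in> borel_measurable borel"
    and integrable_osc: "integrable lborel (osc N g)"
begin

lemma osc_borel_measurable [measurable]: "osc N g \<in> borel_measurable borel"
  by (rule osc_measurable) (simp_all add: finite_measure_axioms)

lemma integrable_weight_osc:
  assumes "\<And>\<xi>. norm (c \<xi>) \<le> (1::real)" "c \<in> borel_measurable borel"
  shows "integrable lborel (\<lambda>\<xi>. complex_of_real (c \<xi>) * iexp (- (\<xi> * y)) * osc N g \<xi>)"
proof (rule Bochner_Integration.integrable_bound[OF integrable_osc])
  note [measurable] = assms(2)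
  show "(\<lambda>\<xi>. complex_of_real (c \<xi>) * iexp (- (\<xi> * y)) * osc N g \<xi>) \<in> borel_measurable lborel"
    by measurable
  show "AE \<xi> in lborel. norm (complex_of_real (c \<xi>) * iexp (- (\<xi> * y)) * osc N g \<xi>) \<le> norm (osc N g \<xi>)"
    using assms(1) by (auto simp: norm_mult intro!: mult_left_le_one_le)
qed

lemma mollified_occupation_eq:
  assumes "a > 0"
  shows "of_real (mollified_occupation N g a y) =
    (CLBINT \<xi>. of_real (std_normal_density (\<xi> / a)) * iexp (- (\<xi> * y)) * osc N g \<xi>)"
  unfolding mollified_occupation_def
  by (rule mollified_occupation_eq_Fourier) (simp_all add: finite_measure_axioms assms)

lemma mollified_occupation_le:
  assumes "a > 0"
  shows "mollified_occupation N g a y \<le> (LBINT \<xi>. norm (osc N g \<xi>))"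
proof -
  let ?h = "\<lambda>\<xi>. of_real (std_normal_density (\<xi> / a)) * iexp (- (\<xi> * y)) * osc N g \<xi>"
  have "mollified_occupation N g a y = norm (CLBINT \<xi>. ?h \<xi>)"
    unfolding mollified_occupation_eq[OF assms, symmetric] using assms by simp
  also have "\<dots> \<le> (LBINT \<xi>. norm (?h \<xi>))"
    by (rule integral_norm_bound)
  also have "\<dots> \<le> (LBINT \<xi>. norm (osc N g \<xi>))"
  proof (rule integral_mono)
    show "integrable lborel (\<lambda>\<xi>. norm (?h \<xi>))"
      using std_normal_density_le_1 by (intro integrable_norm integrable_weight_osc) auto
    show "integrable lborel (\<lambda>\<xi>. norm (osc N g \<xi>))"
      by (intro integrable_norm integrable_osc)
    show "norm (?h \<xi>) \<le> norm (osc N g \<xi>)" for \<xi>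
      using std_normal_density_le_1[of "\<xi> / a"] by (auto simp: norm_mult intro!: mult_left_le_one_le)
  qed
  finally show ?thesis .
qed

lemma mollified_occupation_near_local_time:
  obtains e :: "nat \<Rightarrow> real" where "e \<longlonglongrightarrow> 0"
    "\<And>k y. \<bar>mollified_occupation N g (Suc k) y - local_time N g y\<bar> \<le> e k"
proof
  define d where "d k \<xi> = std_normal_density (\<xi> / real (Suc k)) - std_normal_density 0" for k \<xi>
  have d_le: "norm (d k \<xi>) \<le> 1" for k \<xi>
    using std_normal_density_le[of "\<xi> / Suc k"] std_normal_density_le_1[of 0]
      normal_density_nonneg[of 0 1 "\<xi> / Suc k"] unfolding d_def real_norm_def by linarith
  have [measurable]: "d k \<in> borel_measurable borel" for k
    unfolding d_def[abs_def] by measurable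
  let ?e = "\<lambda>k. LBINT \<xi>. norm (complex_of_real (d k \<xi>) * osc N g \<xi>)"
  have "?e \<longlonglongrightarrow> (LBINT (\<xi>::real). 0)"
  proof (rule integral_dominated_convergence[where w = "\<lambda>\<xi>. norm (osc N g \<xi>)"])
    show "integrable lborel (\<lambda>\<xi>. norm (osc N g \<xi>))"
      by (intro integrable_norm integrable_osc)
    show "AE \<xi> in lborel. norm (norm (complex_of_real (d k \<xi>) * osc N g \<xi>)) \<le> norm (osc N g \<xi>)" for k
      using d_le by (auto simp: norm_mult intro!: mult_left_le_one_le)
    show "AE \<xi> in lborel. (\<lambda>k. norm (complex_of_real (d k \<xi>) * osc N g \<xi>)) \<longlonglongrightarrow> 0"
    proof (rule AE_I2)
      fix \<xi>
      have "(\<lambda>k. \<xi> / real (Suc k)) \<longlonglongrightarrow> 0" by real_asymp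
      moreover have "isCont std_normal_density 0"
        unfolding std_normal_density_def[abs_def] by (intro continuous_intros) auto
      ultimately have "(\<lambda>k. std_normal_density (\<xi> / real (Suc k))) \<longlonglongrightarrow> std_normal_density 0"
        using isCont_tendsto_compose by blast
      then have "(\<lambda>k. d k \<xi>) \<longlonglongrightarrow> 0"
        unfolding d_def using LIM_zero by blast
      then have "(\<lambda>k. complex_of_real (d k \<xi>) * osc N g \<xi>) \<longlonglongrightarrow> of_real 0 * osc N g \<xi>"
        by (intro tendsto_intros)
      then show "(\<lambda>k. norm (complex_of_real (d k \<xi>) * osc N g \<xi>)) \<longlonglongrightarrow> 0"
        using tendsto_norm_zero by simp
    qed
  qed auto
  then show "?e \<longlonglongrightarrow> 0" by simp
  show "\<bar>mollified_occupation N g (Suc k) y - local_time N g y\<bar> \<le> ?e k" for k y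
  proof -
    have "mollified_occupation N g (Suc k) y - local_time N g y = Re (of_real (mollified_occupation N g (Suc k) y) -
        (CLBINT \<xi>. of_real (std_normal_density 0) * iexp (- (\<xi> * y)) * osc N g \<xi>))"
      by (simp add: local_time_def)
    also have "of_real (mollified_occupation N g (Suc k) y) -
        (CLBINT \<xi>. of_real (std_normal_density 0) * iexp (- (\<xi> * y)) * osc N g \<xi>)
      = (CLBINT \<xi>. of_real (std_normal_density (\<xi> / Suc k)) * iexp (- (\<xi> * y)) * osc N g \<xi>
          - of_real (std_normal_density 0) * iexp (- (\<xi> * y)) * osc N g \<xi>)"
      unfolding mollified_occupation_eq[of "Suc k", OF of_nat_0_less_iff[THEN iffD2, OF zero_less_Suc]]
      using std_normal_density_le_1
      by (intro Bochner_Integration.integral_diff[symmetric] integrable_weight_osc) auto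
    also have "\<dots> = (CLBINT \<xi>. of_real (d k \<xi>) * iexp (- (\<xi> * y)) * osc N g \<xi>)"
      by (simp add: d_def algebra_simps)
    also have "\<bar>Re \<dots>\<bar> \<le> norm \<dots>"
      by (rule abs_Re_le_cmod)
    also have "\<dots> \<le> (LBINT \<xi>. norm (of_real (d k \<xi>) * iexp (- (\<xi> * y)) * osc N g \<xi>))"
      by (rule integral_norm_bound)
    also have "\<dots> = ?e k"
      by (simp add: norm_mult)
    finally show ?thesis .
  qed
qed

lemma continuous_local_time: "continuous_on UNIV (local_time N g)"
proof -
  let ?h = "\<lambda>y \<xi>. of_real (std_normal_density 0) * iexp (- (\<xi> * y)) * osc N g \<xi>"
  have "(\<lambda>n. CLBINT \<xi>. ?h (u n) \<xi>) \<longlonglongrightarrow> (CLBINT \<xi>. ?h y \<xi>)" if "u \<longlonglongrightarrow> y" for u y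
  proof (rule integral_dominated_convergence[where w = "\<lambda>\<xi>. norm (osc N g \<xi>)"])
    show "integrable lborel (\<lambda>\<xi>. norm (osc N g \<xi>))"
      by (intro integrable_norm integrable_osc)
    show "AE \<xi> in lborel. norm (?h (u n) \<xi>) \<le> norm (osc N g \<xi>)" for n
      using std_normal_density_le_1[of 0] by (auto simp: norm_mult intro!: mult_left_le_one_le)
    show "AE \<xi> in lborel. (\<lambda>n. ?h (u n) \<xi>) \<longlonglongrightarrow> ?h y \<xi>"
      using that by (intro AE_I2 tendsto_intros)
  qed auto
  then have "(\<lambda>n. local_time N g (u n)) \<longlonglongrightarrow> local_time N g y" if "u \<longlonglongrightarrow> y" for u y
    unfolding local_time_def using that tendsto_Re by blast
  then show ?thesis
    by (auto simp: continuous_on_sequentially comp_def)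
qed

lemma emeasure_small_local_time:
  assumes A: "\<And>t. \<bar>g t\<bar> < A" and \<delta>: "\<delta> > 0"
  shows "emeasure N {t. local_time N g (g t) < \<delta>} \<le> ennreal (4 * A * \<delta>)"
proof -
  have "A > 0" using A[of 0] by linarith
  define S where "S = {y. local_time N g y < \<delta>} \<inter> {-A<..<A}"
  have "open S"
    unfolding S_def
    by (intro open_Int open_Collect_less continuous_local_time continuous_on_const) auto
  then have [measurable]: "S \<in> sets borel" by simp
  define \<Phi> where "\<Phi> k t = (\<integral>\<^sup>+y. ennreal (gauss_kernel (Suc k) (g t - y)) * indicator S y \<partial>lborel)" for k t
  interpret P: pair_sigma_finite N lborel ..
  have [measurable]: "\<Phi> k \<in> borel_measurable borel" for k
    unfolding \<Phi>_def[abs_def] by measurable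
  obtain e where e: "e \<longlonglongrightarrow> 0" 
    and e_le: "\<And>k y. \<bar>mollified_occupation N g (Suc k) y - local_time N g y\<bar> \<le> e k"
    using mollified_occupation_near_local_time by metis
  have "emeasure N {t. local_time N g (g t) < \<delta>} = emeasure N {t. g t \<in> S}"
    using A by (intro arg_cong[where f = "emeasure N"]) (auto simp: S_def abs_less_iff minus_less_iff)
  also have "\<dots> = (\<integral>\<^sup>+t. indicator {t. g t \<in> S} t \<partial>N)"
    by (rule nn_integral_indicator[symmetric]) measurable
  also have "\<dots> \<le> (\<integral>\<^sup>+t. liminf (\<lambda>k. \<Phi> k t) \<partial>N)"
  proof (rule nn_integral_mono)
    fix t
    show "indicator {t. g t \<in> S} t \<le> liminf (\<lambda>k. \<Phi> k t)"
    proof (cases "g t \<in> S")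
      case True
      then obtain r where r: "r > 0" "ball (g t) r \<subseteq> S"
        using \<open>open S\<close> openE by blast
      have "\<forall>\<^sub>F k in sequentially. 1 / real (Suc k) < r"
        using r(1) by real_asymp
      then have "\<forall>\<^sub>F k in sequentially. 1 \<le> \<Phi> k t"
      proof eventually_elim
        case (elim k)
        then have "ball (g t) (1 / real (Suc k)) \<subseteq> S" using r(2) by force
        then show ?case
          unfolding \<Phi>_def by (intro gauss_kernel_integral_ge_1) auto
      qed
      then have "1 \<le> liminf (\<lambda>k. \<Phi> k t)"
        by (rule Liminf_bounded)
      then show ?thesis by (simp add: indicator_def)
    qed auto
  qed
  also have "\<dots> \<le> liminf (\<lambda>k. \<integral>\<^sup>+t. \<Phi> k t \<partial>N)"
    by (rule nn_integral_liminf) measurable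
  also have "\<dots> \<le> ennreal (4 * A * \<delta>)"
  proof (rule Liminf_le)
    have "\<forall>\<^sub>F k in sequentially. e k < \<delta>"
      using e \<delta> by (rule order_tendstoD)
    then show "\<forall>\<^sub>F k in sequentially. (\<integral>\<^sup>+t. \<Phi> k t \<partial>N) \<le> ennreal (4 * A * \<delta>)"
    proof eventually_elim
      case (elim k)
      have "(\<integral>\<^sup>+t. \<Phi> k t \<partial>N) = (\<integral>\<^sup>+y. (\<integral>\<^sup>+t. ennreal (gauss_kernel (Suc k) (g t - y)) * indicator S y \<partial>N) \<partial>lborel)"
        unfolding \<Phi>_def by (rule P.Fubini'[symmetric]) measurable
      also have "\<dots> = (\<integral>\<^sup>+y. ennreal (mollified_occupation N g (Suc k) y) * indicator S y \<partial>lborel)"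
      proof (intro nn_integral_cong)
        fix y
        have "integrable N (\<lambda>t. gauss_kernel (Suc k) (g t - y))"
          using gauss_kernel_le[of "Suc k"] 
          by (intro integrable_const_bound[where B = "Suc k"]) auto
        then show "(\<integral>\<^sup>+t. ennreal (gauss_kernel (Suc k) (g t - y)) * indicator S y \<partial>N)
           = ennreal (mollified_occupation N g (Suc k) y) * indicator S y"
          by (subst nn_integral_multc) (auto simp: mollified_occupation_def nn_integral_eq_integral)
      qed
      also have "\<dots> \<le> (\<integral>\<^sup>+y. ennreal (2 * \<delta>) * indicator {-A<..<A} y \<partial>lborel)"
      proof (rule nn_integral_mono)
        fix y
        show "ennreal (mollified_occupation N g (Suc k) y) * indicator S y \<le> ennreal (2 * \<delta>) * indicator {-A<..<A} y"
        proof (cases "y \<in> S")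
          case True
          then have "mollified_occupation N g (Suc k) y \<le> 2 * \<delta>"
            using e_le[of k y] elim by (auto simp: S_def)
          then show ?thesis using True by (auto simp: S_def indicator_def intro: ennreal_leI)
        qed auto
      qed
      also have "\<dots> = ennreal (4 * A * \<delta>)"
        using \<open>A > 0\<close> \<delta>
        by (subst nn_integral_cmult_indicator) (auto simp: ennreal_mult'[symmetric] algebra_simps)
      finally show ?case .
    qed
  qed simp
  finally show ?thesis .
qed

lemma AE_local_time_pos:
  assumes A: "\<And>t. \<bar>g t\<bar> < A"
  shows "AE t in N. local_time N g (g t) > 0"
proof -
  have "A > 0" using A[of 0] by linarith
  have [measurable]: "local_time N g \<in> borel_measurable borel"
    using continuous_local_time by (rule borel_measurable_continuous_onI)
  have "emeasure N {t. local_time N g (g t) \<le> 0} \<le> ennreal \<delta>" if "\<delta> > 0" for \<delta>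
  proof -
    have "emeasure N {t. local_time N g (g t) \<le> 0} \<le> emeasure N {t. local_time N g (g t) < \<delta> / (4 * A)}"
      using that \<open>A > 0\<close> by (intro emeasure_mono) (auto simp: le_less_trans)
    also have "\<dots> \<le> ennreal (4 * A * (\<delta> / (4 * A)))"
      using that \<open>A > 0\<close> by (intro emeasure_small_local_time A) auto
    finally show ?thesis using \<open>A > 0\<close> by simp
  qed
  then have "emeasure N {t. local_time N g (g t) \<le> 0} = 0"
    by (metis ennreal_0 ennreal_le_epsilon le_zero_eq add_0)
  then have "AE t in N. \<not> local_time N g (g t) \<le> 0"
    by (subst AE_iff_measurable[OF _ refl]) (auto simp: sets_eq_imp_space_eq[OF sets_N])
  then show ?thesis by (simp add: not_le)
qed

end

section \<open>Dimension of the fibres\<close>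

lemma hausdorff_measure_unit_interval_eq_0:
  assumes E: "E \<subseteq> {0..1::real}" and s: "s > 1"
  shows "hausdorff_measure s E = 0"
proof -
  have "hausdorff_premeasure s \<delta> E \<le> 0" if "\<delta> > 0" for \<delta>
  proof (rule tendsto_lowerbound)
    let ?U = "\<lambda>N i. if i < Suc N then {real i / Suc N .. real (Suc i) / Suc N} else {}"
    show "(\<lambda>N. ennreal (Suc N * (1 / Suc N) powr s)) \<longlonglongrightarrow> 0"
    proof -
      have "(\<lambda>N. Suc N * (1 / Suc N) powr s) \<longlonglongrightarrow> 0"
        using s by real_asymp
      from tendsto_ennrealI[OF this] show ?thesis by simp
    qed
    have "\<forall>\<^sub>F N in sequentially. 1 / real (Suc N) < \<delta>"
      using that by real_asymp
    then show "\<forall>\<^sub>F N in sequentially. hausdorff_premeasure s \<delta> E \<le> ennreal (Suc N * (1 / Suc N) powr s)"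
    proof eventually_elim
      case (elim N)
      have diam: "diameter {real i / Suc N .. real (Suc i) / Suc N} = 1 / Suc N" for i
        by (subst diameter_closed_interval) (auto simp: field_simps)
      have "E \<subseteq> (\<Union>i. ?U N i)"
      proof
        fix t assume "t \<in> E"
        then have t: "0 \<le> t" "t \<le> 1" using E by auto
        show "t \<in> (\<Union>i. ?U N i)"
        proof (cases "t = 1")
          case True
          then show ?thesis by (intro UN_I[of N]) (auto simp: field_simps)
        next
          case False
          define i where "i = nat \<lfloor>t * Suc N\<rfloor>"
          have "real i \<le> t * Suc N" "t * Suc N < real i + 1"
            unfolding i_def using t by (auto simp: of_nat_nat)
          moreover have "t * real (Suc N) < 1 * real (Suc N)"
            using t False by (intro mult_strict_right_mono) auto
          ultimately show ?thesis
            by (intro UN_I[of i]) (auto simp: field_simps)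
        qed
      qed
      moreover have "bounded (?U N i) \<and> diameter (?U N i) \<le> \<delta>" for i
        using elim that diam[of i] by auto
      ultimately have "hausdorff_premeasure s \<delta> E \<le> (\<Sum>i. diam_power s (?U N i))"
        unfolding hausdorff_premeasure_def by (intro INF_lower) blast
      also have "\<dots> = (\<Sum>i<Suc N. diam_power s (?U N i))"
        by (rule suminf_finite) (auto simp: diam_power_def)
      also have "\<dots> = (\<Sum>i<Suc N. ennreal ((1 / Suc N) powr s))"
      proof (rule sum.cong[OF refl])
        fix i assume "i \<in> {..<Suc N}"
        then have U: "?U N i = {real i / Suc N .. real (Suc i) / Suc N}" by simp
        have "real i / Suc N \<le> real (Suc i) / Suc N" by (simp add: divide_right_mono)
        then show "diam_power s (?U N i) = ennreal ((1 / Suc N) powr s)"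
          unfolding U diam_power_def diam using s by simp
      qed
      also have "\<dots> = ennreal (Suc N * (1 / Suc N) powr s)"
        by (subst sum_ennreal) (simp_all del: of_nat_Suc)
      finally show ?case .
    qed
  qed simp
  then have "hausdorff_premeasure s \<delta> E = 0" if "\<delta> > 0" for \<delta>
    using that by (simp add: le_zero_eq)
  then show ?thesis
    unfolding hausdorff_measure_def by (intro SUP_eq_const) auto
qed

lemma hausdorff_premeasure_lessE:
  assumes "hausdorff_premeasure s \<delta> A < c"
  obtains U where "A \<subseteq> (\<Union>i. U i)" "\<And>i. bounded (U i)" "\<And>i. diameter (U i) \<le> \<delta>"
    "(\<Sum>i. diam_power s (U i)) < c"
  using assms unfolding hausdorff_premeasure_def INF_less_iff by blast

lemma hausdorff_dim_eq_1:
  assumes E: "E \<subseteq> {0..1::real}" "E \<noteq> {}"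
    and pos: "\<And>s. 0 \<le> s \<Longrightarrow> s < 1 \<Longrightarrow> hausdorff_measure s E \<noteq> 0"
  shows "hausdorff_dim E = 1"
proof -
  let ?Z = "ereal ` {s. 0 \<le> s \<and> hausdorff_measure s E = 0}"
  have "1 \<le> Inf ?Z"
  proof (rule Inf_greatest)
    fix x assume "x \<in> ?Z"
    then obtain s where s: "x = ereal s" "0 \<le> s" "hausdorff_measure s E = 0" by auto
    then have "1 \<le> s" using pos by (meson not_le)
    then show "1 \<le> x" using s by (simp add: one_ereal_def)
  qed
  moreover have "Inf ?Z \<le> 1"
  proof (rule dense_ge)
    fix x :: ereal assume "1 < x"
    then obtain r where r: "1 < ereal r" "ereal r < x"
      using ereal_dense2 by blast
    then have "ereal r \<in> ?Z"
      using hausdorff_measure_unit_interval_eq_0[OF E(1), of r] by (auto simp: one_ereal_def)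
    then show "Inf ?Z \<le> x"
      using r(2) by (intro order_trans[OF Inf_lower less_imp_le]) auto
  qed
  ultimately show ?thesis
    using E(2) by (simp add: hausdorff_dim_def)
qed

abbreviation dyadic_ball :: "nat \<Rightarrow> nat \<Rightarrow> real set" where
  "dyadic_ball n j \<equiv> ball (real j / 2 ^ n) (2 / 2 ^ n)"

definition window :: "nat \<Rightarrow> nat \<Rightarrow> real measure" where
  "window n j = density lborel (\<lambda>t. ennreal (indicator ({0..1} \<inter> dyadic_ball n j) t))"

lemma dyadic_window_borel [measurable, simp]: "{0..1} \<inter> dyadic_ball n j \<in> sets borel"
  by (intro sets.Int) auto

lemma sets_window [simp, measurable_cong]: "sets (window n j) = sets borel"
  by (simp add: window_def)

lemma space_window [simp]: "space (window n j) = UNIV"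
  by (simp add: window_def)

lemma emeasure_window:
  assumes "A \<in> sets borel"
  shows "emeasure (window n j) A = emeasure lborel (A \<inter> {0..1} \<inter> dyadic_ball n j)"
proof -
  have "emeasure (window n j) A =
      (\<integral>\<^sup>+t. ennreal (indicator ({0..1} \<inter> dyadic_ball n j) t) * indicator A t \<partial>lborel)"
    unfolding window_def using assms by (intro emeasure_density) auto
  also have "\<dots> = (\<integral>\<^sup>+t. indicator (A \<inter> {0..1} \<inter> dyadic_ball n j) t \<partial>lborel)"
    by (intro nn_integral_cong) (simp split: split_indicator)
  also have "\<dots> = emeasure lborel (A \<inter> {0..1} \<inter> dyadic_ball n j)"
    using assms by (intro nn_integral_indicator) auto
  finally show ?thesis .
qed

lemma emeasure_space_window_le: "emeasure (window n j) UNIV \<le> ennreal (4 / 2 ^ n)"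
proof -
  have "emeasure (window n j) UNIV \<le> emeasure lborel (dyadic_ball n j)"
    by (subst emeasure_window) (auto intro: emeasure_mono)
  also have "dyadic_ball n j = {real j / 2 ^ n - 2 / 2 ^ n<..<real j / 2 ^ n + 2 / 2 ^ n}"
    by (simp add: ball_eq_greaterThanLessThan)
  finally show ?thesis by simp
qed

lemma emeasure_space_window_le_1: "emeasure (window n j) UNIV \<le> 1"
proof -
  have "emeasure (window n j) UNIV \<le> emeasure lborel {0..1::real}"
    by (subst emeasure_window) (auto intro!: emeasure_mono simp del: emeasure_lborel_Icc_eq emeasure_lborel_Icc)
  then show ?thesis by simp
qed

lemma finite_measure_window: "finite_measure (window n j)"
  using emeasure_space_window_le_1[of n j] by (intro finite_measureI) (auto simp: top_unique)

lemma emeasure_window_0: "A \<in> sets borel \<Longrightarrow> emeasure (window 0 0) A = emeasure lborel (A \<inter> {0..1})"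
proof -
  assume "A \<in> sets borel"
  moreover have "A \<inter> {0..1} \<inter> dyadic_ball 0 0 = A \<inter> {0..1}" by (auto simp: dist_real_def)
  ultimately show ?thesis by (simp add: emeasure_window)
qed

lemma mollified_occupation_window:
  assumes [measurable]: "g \<in> borel_measurable borel"
  shows "mollified_occupation (window n j) g a y =
    (LBINT t. indicator ({0..1} \<inter> dyadic_ball n j) t * gauss_kernel a (g t - y))"
  unfolding mollified_occupation_def window_def
  by (subst integral_density) (auto intro!: borel_measurable_indicator)

text \<open>
  At frequencies beyond the cutoff the expected oscillatory integral beats \<open>8\<^sup>-\<^sup>n\<close>, which is enough to sum
  over the \<open>2\<^sup>n + 1\<close> windows of level \<open>n\<close> with weight \<open>2\<^sup>n\<close>; below it the trivial bound by the mass of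
  the window costs only a factor polynomial in \<open>n\<close>.
\<close>

definition cutoff :: "nat \<Rightarrow> real" where
  "cutoff n = (12 * real n) ^ 3"

locale tame_path =
  fixes g :: "real \<Rightarrow> real" and S :: real
  assumes cont: "continuous_on UNIV g"
    and S_nonneg: "S \<ge> 0"
    and tail: "\<And>n j. j \<le> 2 ^ n \<Longrightarrow>
      (\<integral>\<^sup>+\<xi>. ennreal (norm (osc (window n j) g \<xi>)) * indicator {\<xi>. cutoff n \<le> \<bar>\<xi>\<bar>} \<xi> \<partial>lborel) \<le> ennreal (S / 2 ^ n)"
begin

definition bound :: "nat \<Rightarrow> real" where
  "bound n = (8 * cutoff n + S) / 2 ^ n"

lemma g_measurable [measurable]: "g \<in> borel_measurable borel"
  using cont by (rule borel_measurable_continuous_onI)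

lemma cutoff_nonneg: "cutoff n \<ge> 0"
  by (simp add: cutoff_def)

lemma bound_nonneg: "bound n \<ge> 0"
  using cutoff_nonneg S_nonneg by (simp add: bound_def)

lemma osc_window_measurable [measurable]: "osc (window n j) g \<in> borel_measurable borel"
  by (rule osc_measurable) (simp_all add: finite_measure_window)

lemma nn_integral_osc_le:
  assumes "j \<le> 2 ^ n"
  shows "(\<integral>\<^sup>+\<xi>. ennreal (norm (osc (window n j) g \<xi>)) \<partial>lborel) \<le> ennreal (bound n)"
proof -
  let ?u = "\<lambda>\<xi>. ennreal (norm (osc (window n j) g \<xi>))"
  have u_le: "?u \<xi> \<le> ennreal (4 / 2 ^ n)" for \<xi>
  proof -
    interpret finite_measure "window n j" by (rule finite_measure_window)
    have "?u \<xi> \<le> ennreal (measure (window n j) (space (window n j)))"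
      using norm_osc_le[OF finite_measure_window] by (rule ennreal_leI)
    also have "\<dots> \<le> ennreal (4 / 2 ^ n)"
      using emeasure_space_window_le[of n j] by (simp add: emeasure_eq_measure)
    finally show ?thesis .
  qed
  have "(\<integral>\<^sup>+\<xi>. ?u \<xi> \<partial>lborel) \<le>
    (\<integral>\<^sup>+\<xi>. ennreal (4 / 2 ^ n) * indicator {- cutoff n..cutoff n} \<xi>
       + ?u \<xi> * indicator {\<xi>. cutoff n \<le> \<bar>\<xi>\<bar>} \<xi> \<partial>lborel)"
    using u_le by (intro nn_integral_mono) (auto simp: indicator_def add_increasing2)
  also have "\<dots> = ennreal (4 / 2 ^ n) * ennreal (2 * cutoff n) +
      (\<integral>\<^sup>+\<xi>. ?u \<xi> * indicator {\<xi>. cutoff n \<le> \<bar>\<xi>\<bar>} \<xi> \<partial>lborel)"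
    using cutoff_nonneg
    by (subst nn_integral_add) (auto simp: nn_integral_cmult_indicator)
  also have "\<dots> \<le> ennreal (4 / 2 ^ n) * ennreal (2 * cutoff n) + ennreal (S / 2 ^ n)"
    using tail[OF assms] by (rule add_left_mono)
  also have "\<dots> = ennreal (bound n)"
    using cutoff_nonneg[of n] S_nonneg
    by (simp add: bound_def add_divide_distrib flip: ennreal_mult ennreal_plus)
  finally show ?thesis .
qed

lemma integrable_osc_window:
  assumes "j \<le> 2 ^ n"
  shows "integrable_osc (window n j) g"
proof -
  interpret finite_measure "window n j" by (rule finite_measure_window)
  show ?thesis
  proof
    show "integrable lborel (osc (window n j) g)"
      using nn_integral_osc_le[OF assms] by (intro integrableI_bounded) (auto intro: le_less_trans)
  qed auto
qed

lemma integral_norm_osc_le: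
  assumes "j \<le> 2 ^ n"
  shows "(LBINT \<xi>. norm (osc (window n j) g \<xi>)) \<le> bound n"
  using nn_integral_osc_le[OF assms] bound_nonneg
  by (subst integral_eq_nn_integral) (auto intro: enn2real_leI)

lemma local_time_le_cover:
  fixes m :: "'i \<Rightarrow> nat" and j :: "'i \<Rightarrow> nat"
  assumes "finite I" and j: "\<And>i. i \<in> I \<Longrightarrow> j i \<le> 2 ^ m i"
    and cover: "{t \<in> {0..1}. g t = y} \<subseteq> (\<Union>i\<in>I. dyadic_ball (m i) (j i))"
  shows "local_time (window 0 0) g y \<le> (\<Sum>i\<in>I. bound (m i))"
proof -
  define K where "K = {0..1} - (\<Union>i\<in>I. dyadic_ball (m i) (j i))"
  have "compact K"
    unfolding K_def by (intro compact_diff open_UN) auto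
  obtain \<delta> where \<delta>: "\<delta> > 0" "\<And>t. t \<in> K \<Longrightarrow> \<delta> \<le> \<bar>g t - y\<bar>"
  proof (cases "K = {}")
    case True
    then show ?thesis using that[of 1] by simp
  next
    case False
    have "continuous_on K (\<lambda>t. \<bar>g t - y\<bar>)"
      by (intro continuous_intros continuous_on_subset[OF cont]) auto
    then obtain t0 where t0: "t0 \<in> K" "\<And>t. t \<in> K \<Longrightarrow> \<bar>g t0 - y\<bar> \<le> \<bar>g t - y\<bar>"
      using continuous_attains_inf[OF \<open>compact K\<close> False] by metis
    have "g t0 \<noteq> y" using t0(1) cover unfolding K_def by auto
    then show ?thesis using that[of "\<bar>g t0 - y\<bar>"] t0 by simp
  qed
  interpret I0: integrable_osc "window 0 0" g by (rule integrable_osc_window) simp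
  have kernel_mono: "gauss_kernel a x \<le> gauss_kernel a \<delta>" if "a > 0" "\<delta> \<le> \<bar>x\<bar>" for a x
  proof -
    have "(a * \<delta>)\<^sup>2 \<le> (a * x)\<^sup>2"
      using that \<delta>(1) by (simp add: power_mult_distrib abs_le_square_iff[symmetric])
    then show ?thesis using that by (simp add: gauss_kernel_def)
  qed
  have le: "mollified_occupation (window 0 0) g a y \<le> (\<Sum>i\<in>I. bound (m i)) + gauss_kernel a \<delta>"
    if a: "a > 0" for a
  proof -
    let ?W = "\<lambda>n j. {0..1} \<inter> dyadic_ball n j"
    let ?k = "\<lambda>t. gauss_kernel a (g t - y)"
    have int: "integrable lborel (\<lambda>t. indicator A t * ?k t)" if "A \<subseteq> {0..1}" "A \<in> sets borel" for A
    proof (rule Bochner_Integration.integrable_bound)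
      show "integrable lborel (\<lambda>t::real. a * indicator {0..1} t :: real)"
        by (intro integrable_mult_right integrable_real_indicator) auto
      show "AE t in lborel. norm (indicator A t * ?k t) \<le> norm (a * indicator {0..1} t :: real)"
        using a gauss_kernel_le[OF a] that by (intro AE_I2) (auto simp: indicator_def)
    qed (use that in auto)
    have "mollified_occupation (window 0 0) g a y = (LBINT t. indicator (?W 0 0) t * ?k t)"
      by (rule mollified_occupation_window) simp
    also have "\<dots> \<le> (LBINT t. (\<Sum>i\<in>I. indicator (?W (m i) (j i)) t * ?k t) + gauss_kernel a \<delta> * indicator {0..1} t)"
    proof (rule integral_mono)
      fix t
      have nn: "0 \<le> (\<Sum>i\<in>I. indicator (?W (m i) (j i)) t * ?k t)"
        using a by (intro sum_nonneg) auto
      show "indicator (?W 0 0) t * ?k t \<le> (\<Sum>i\<in>I. indicator (?W (m i) (j i)) t * ?k t) + gauss_kernel a \<delta> * indicator {0..1} t"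
      proof (cases "t \<in> {0..1}")
        case True
        show ?thesis
        proof (cases "t \<in> K")
          case True
          then show ?thesis
            using nn kernel_mono[OF a \<delta>(2)[OF True]] \<open>t \<in> {0..1}\<close> a by (auto simp: indicator_def)
        next
          case False
          then obtain i where i: "i \<in> I" "t \<in> ?W (m i) (j i)" using True by (auto simp: K_def)
          then have "?k t = indicator (?W (m i) (j i)) t * ?k t" by simp
          also have "\<dots> \<le> (\<Sum>i\<in>I. indicator (?W (m i) (j i)) t * ?k t)"
            using a i by (intro member_le_sum \<open>finite I\<close>) auto
          finally show ?thesis
            using a True by (auto simp: indicator_def add_increasing2)
        qed
      qed (use nn in auto)
    qed (auto intro!: int Bochner_Integration.integrable_add Bochner_Integration.integrable_sum)
    also have "\<dots> = (LBINT t. \<Sum>i\<in>I. indicator (?W (m i) (j i)) t * ?k t) + gauss_kernel a \<delta>"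
      by (subst Bochner_Integration.integral_add) (auto intro!: int Bochner_Integration.integrable_sum)
    also have "(LBINT t. \<Sum>i\<in>I. indicator (?W (m i) (j i)) t * ?k t)
        = (\<Sum>i\<in>I. LBINT t. indicator (?W (m i) (j i)) t * ?k t)"
      by (rule Bochner_Integration.integral_sum) (auto intro!: int)
    also have "(\<Sum>i\<in>I. LBINT t. indicator (?W (m i) (j i)) t * ?k t) \<le> (\<Sum>i\<in>I. bound (m i))"
    proof (rule sum_mono)
      fix i assume i: "i \<in> I"
      interpret J: integrable_osc "window (m i) (j i)" g by (rule integrable_osc_window[OF j[OF i]])
      show "(LBINT t. indicator (?W (m i) (j i)) t * ?k t) \<le> bound (m i)"
        using J.mollified_occupation_le[OF a] integral_norm_osc_le[OF j[OF i]]
        by (simp flip: mollified_occupation_window) (meson order_trans)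
    qed
    finally show ?thesis by simp
  qed
  obtain e where e: "e \<longlonglongrightarrow> 0"
    and e_le: "\<And>k y. \<bar>mollified_occupation (window 0 0) g (Suc k) y - local_time (window 0 0) g y\<bar> \<le> e k"
    using I0.mollified_occupation_near_local_time by metis
  have "(\<lambda>k. (\<Sum>i\<in>I. bound (m i)) + gauss_kernel (Suc k) \<delta> + e k) \<longlonglongrightarrow> (\<Sum>i\<in>I. bound (m i)) + 0 + 0"
  proof (intro tendsto_intros e)
    show "(\<lambda>k. gauss_kernel (Suc k) \<delta>) \<longlonglongrightarrow> 0"
      unfolding gauss_kernel_def using \<delta>(1) by real_asymp
  qed
  moreover have "local_time (window 0 0) g y \<le> (\<Sum>i\<in>I. bound (m i)) + gauss_kernel (Suc k) \<delta> + e k" for k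
    using le[of "Suc k"] e_le[of k y] by (simp add: abs_le_iff)
  ultimately show ?thesis
    by (intro LIMSEQ_le_const) auto
qed

lemma bound_le_powr:
  assumes "s < 1"
  obtains K where "K > 0" "\<And>n. bound n \<le> K * (1 / 2 ^ Suc n) powr s"
proof -
  define r :: real where "r = 2 powr (s - 1)"
  have r: "0 < r" "r < 1"
    using assms by (auto simp: r_def intro: powr_less_one)
  have eq: "(2 ^ Suc n) powr s / 2 ^ n = 2 powr s * r ^ n" for n
  proof -
    have "(2 ^ Suc n) powr s = 2 powr s * (2 powr s) ^ n"
      by (simp add: powr_mult powr_power mult.commute powr_powr flip: powr_realpow)
    moreover have "r = 2 powr s / 2"
      by (simp add: r_def powr_diff)
    ultimately show ?thesis by (simp only: power_divide times_divide_eq_right)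
  qed
  have "bound n * (2 ^ Suc n) powr s = 2 powr s * ((8 * (12 * real n) ^ 3 + S) * r ^ n)" for n
  proof -
    have "bound n * (2 ^ Suc n) powr s = (8 * (12 * real n) ^ 3 + S) * ((2 ^ Suc n) powr s / 2 ^ n)"
      unfolding bound_def cutoff_def by simp
    then show ?thesis unfolding eq by simp
  qed
  moreover have "(\<lambda>n. (8 * (12 * real n) ^ 3 + S) * r ^ n) \<longlonglongrightarrow> 0"
    using r by real_asymp
  ultimately have "(\<lambda>n. bound n * (2 ^ Suc n) powr s) \<longlonglongrightarrow> 0"
    by (simp add: tendsto_mult_right_zero)
  then obtain K where K: "K > 0" "\<And>n. norm (bound n * (2 ^ Suc n) powr s) \<le> K"
    by (meson convergent_imp_Bseq convergentI BseqE)
  have "bound n \<le> K * (1 / 2 ^ Suc n) powr s" for n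
  proof -
    have "bound n * (2 ^ Suc n) powr s \<le> K"
      using K(2)[of n] by simp
    then have "bound n \<le> K / (2 ^ Suc n) powr s"
      by (subst pos_le_divide_eq) auto
    then show ?thesis
      by (simp add: powr_divide del: power_Suc)
  qed
  with K(1) show ?thesis using that by blast
qed

lemma small_dyadic_cover:
  assumes K: "K > 0" "\<And>n. bound n \<le> K * (1 / 2 ^ Suc n) powr s" and s: "0 \<le> s"
    and U: "bounded U" "diameter U \<le> 1 / 2" and \<theta>: "\<theta> > 0"
  obtains n j where "j \<le> 2 ^ n" "U \<inter> {0..1} \<subseteq> dyadic_ball n j"
    "ennreal (bound n) \<le> ennreal K * diam_power s U + ennreal \<theta>"
proof -
  have d: "diameter U \<ge> 0" using diameter_ge_0[OF U(1)] .
  obtain n where n: "diameter U < 1 / 2 ^ n" "ennreal (bound n) \<le> ennreal K * diam_power s U + ennreal \<theta>"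
  proof (cases "diameter U = 0")
    case True
    have "bound \<longlonglongrightarrow> 0"
      unfolding bound_def cutoff_def by real_asymp
    then have "\<forall>\<^sub>F n in sequentially. bound n < \<theta>"
      using \<theta> by (rule order_tendstoD)
    then obtain n where "bound n < \<theta>"
      using eventually_happens by force
    then have "ennreal (bound n) \<le> ennreal K * diam_power s U + ennreal \<theta>"
      by (intro add_increasing ennreal_leI) auto
    then show ?thesis
      using that[of n] True by simp
  next
    case False
    then have "\<exists>m. 1 / 2 ^ m \<le> diameter U"
      using d real_arch_pow_inv[of "diameter U" "1 / 2"] by (auto simp: power_divide intro: less_imp_le)
    then obtain m where m: "1 / 2 ^ m \<le> diameter U" "\<And>k. k < m \<Longrightarrow> \<not> 1 / 2 ^ k \<le> diameter U"
      using exists_least_iff[of "\<lambda>m. 1 / 2 ^ m \<le> diameter U"] by auto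
    obtain n where n: "m = Suc n"
      using m(1) U(2) by (cases m) auto
    have "bound n \<le> K * (1 / 2 ^ Suc n) powr s" by (rule K)
    also have "\<dots> \<le> K * diameter U powr s"
      using m(1) s K(1) unfolding n by (intro mult_left_mono powr_mono2) auto
    finally have "ennreal (bound n) \<le> ennreal K * ennreal (diameter U powr s)"
      using K(1) by (simp add: ennreal_leI flip: ennreal_mult)
    also have "ennreal (diameter U powr s) = diam_power s U"
      using False by (auto simp: diam_power_def)
    finally show ?thesis
      using that[of n] m(2)[of n] n by (auto simp: add_increasing2)
  qed
  show ?thesis
  proof (cases "U \<inter> {0..1} = {}")
    case True
    then show ?thesis using that[of 0 n] n(2) by simp
  next
    case False
    then obtain x where x: "x \<in> U" "0 \<le> x" "x \<le> 1" by auto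
    define j where "j = nat \<lfloor>x * 2 ^ n\<rfloor>"
    have j: "real j \<le> x * 2 ^ n" "x * 2 ^ n < real j + 1"
      unfolding j_def using x by (auto simp: of_nat_nat)
    have "x * 2 ^ n \<le> 1 * 2 ^ n"
      using x by (intro mult_right_mono) auto
    then have "real j \<le> 2 ^ n" using j(1) by linarith
    then have "j \<le> 2 ^ n" by simp
    moreover have "U \<inter> {0..1} \<subseteq> dyadic_ball n j"
    proof
      fix z assume "z \<in> U \<inter> {0..1}"
      then have "dist x z < 1 / 2 ^ n"
        using diameter_bounded_bound[OF U(1) x(1), of z] n(1) by auto
      moreover have "real j / 2 ^ n \<le> x" "x < (real j + 1) / 2 ^ n"
        using j by (simp_all add: pos_divide_le_eq pos_less_divide_eq)
      then have "dist (real j / 2 ^ n) x \<le> 1 / 2 ^ n"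
        by (simp add: dist_real_def abs_le_iff add_divide_distrib)
      ultimately have "dist (real j / 2 ^ n) z < 1 / 2 ^ n + 1 / 2 ^ n"
        using dist_triangle[of "real j / 2 ^ n" z x] by linarith
      then show "z \<in> dyadic_ball n j" by simp
    qed
    ultimately show ?thesis using that n(2) by blast
  qed
qed

lemma hausdorff_dim_fibre:
  assumes pos: "local_time (window 0 0) g y > 0"
  shows "hausdorff_dim {t \<in> {0..1}. g t = y} = 1"
proof (rule hausdorff_dim_eq_1)
  let ?E = "{t \<in> {0..1}. g t = y}"
  let ?p = "local_time (window 0 0) g y"
  show "?E \<noteq> {}"
  proof
    assume "?E = {}"
    then show False
      using local_time_le_cover[of "{}" undefined undefined y] pos by simp
  qed
  have "closed {t. g t = y}"
    using cont by (intro closed_Collect_eq continuous_on_const) auto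
  then have "compact ({0..1} \<inter> {t. g t = y})" by (intro compact_Int_closed) auto
  then have compact: "compact ?E" by (simp add: Int_def)
  fix s :: real assume s: "0 \<le> s" "s < 1"
  obtain K where K: "K > 0" "\<And>n. bound n \<le> K * (1 / 2 ^ Suc n) powr s"
    using bound_le_powr[OF s(2)] by metis
  show "hausdorff_measure s ?E \<noteq> 0"
  proof
    assume 0: "hausdorff_measure s ?E = 0"
    have "hausdorff_premeasure s (1 / 2) ?E \<le> hausdorff_measure s ?E"
      unfolding hausdorff_measure_def by (rule SUP_upper) simp
    also note 0
    also have "0 < ennreal (?p / (4 * K))"
      using pos K(1) by simp
    finally have less: "hausdorff_premeasure s (1 / 2) ?E < ennreal (?p / (4 * K))" .
    obtain U where U: "?E \<subseteq> (\<Union>i. U i)" "\<And>i. bounded (U i)" "\<And>i. diameter (U i) \<le> 1 / 2"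
      and sum_U: "(\<Sum>i. diam_power s (U i)) < ennreal (?p / (4 * K))"
      by (rule hausdorff_premeasure_lessE[OF less]) (rule that)
    have "\<exists>n j. j \<le> 2 ^ n \<and> U i \<inter> {0..1} \<subseteq> dyadic_ball n j \<and>
       ennreal (bound n) \<le> ennreal K * diam_power s (U i) + ennreal (?p / 4 * (1 / 2) ^ Suc i)" for i
    proof -
      have "0 < ?p / 4 * (1 / 2) ^ Suc i" using pos by simp
      then obtain n j where "j \<le> 2 ^ n" "U i \<inter> {0..1} \<subseteq> dyadic_ball n j"
        "ennreal (bound n) \<le> ennreal K * diam_power s (U i) + ennreal (?p / 4 * (1 / 2) ^ Suc i)"
        by (rule small_dyadic_cover[OF K s(1) U(2)[of i] U(3)[of i]]) (rule that)
      then show ?thesis by (intro exI conjI)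
    qed
    then obtain n j where nj: "\<And>i. j i \<le> 2 ^ n i" "\<And>i. U i \<inter> {0..1} \<subseteq> dyadic_ball (n i) (j i)"
      and bd: "\<And>i. ennreal (bound (n i)) \<le> ennreal K * diam_power s (U i) + ennreal (?p / 4 * (1 / 2) ^ Suc i)"
      by metis
    have "?E \<subseteq> (\<Union>i\<in>UNIV. dyadic_ball (n i) (j i))"
      using U(1) nj(2) by blast
    then obtain F where F: "finite F" "?E \<subseteq> (\<Union>i\<in>F. dyadic_ball (n i) (j i))"
      using compactE_image[OF compact, of UNIV "\<lambda>i. dyadic_ball (n i) (j i)"] by auto
    have geo: "(\<lambda>i. ?p / 4 * (1 / 2) ^ Suc i) sums (?p / 4 * 1)"
      by (intro sums_mult power_half_series)
    have "ennreal ?p \<le> ennreal (\<Sum>i\<in>F. bound (n i))"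
      using local_time_le_cover[OF F(1) _ F(2)] nj(1) by (intro ennreal_leI) auto
    also have "\<dots> = (\<Sum>i\<in>F. ennreal (bound (n i)))"
      using bound_nonneg by (simp add: sum_ennreal)
    also have "\<dots> \<le> (\<Sum>i. ennreal (bound (n i)))"
      by (rule sum_le_suminf) (auto simp: F)
    also have "\<dots> \<le> (\<Sum>i. ennreal K * diam_power s (U i) + ennreal (?p / 4 * (1 / 2) ^ Suc i))"
      using bd by (intro suminf_le) auto
    also have "\<dots> = ennreal K * (\<Sum>i. diam_power s (U i)) + (\<Sum>i. ennreal (?p / 4 * (1 / 2) ^ Suc i))"
      by (subst suminf_add[symmetric]) auto
    also have "(\<Sum>i. ennreal (?p / 4 * (1 / 2) ^ Suc i)) = ennreal (?p / 4)"
      using pos geo by (subst suminf_ennreal2) (auto simp: sums_iff)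
    also have "ennreal K * (\<Sum>i. diam_power s (U i)) + ennreal (?p / 4)
        \<le> ennreal K * ennreal (?p / (4 * K)) + ennreal (?p / 4)"
      using sum_U by (intro add_right_mono mult_left_mono) auto
    also have "ennreal K * ennreal (?p / (4 * K)) = ennreal (?p / 4)"
      using K(1) pos by (subst ennreal_mult[symmetric]) auto
    also have "ennreal (?p / 4) + ennreal (?p / 4) = ennreal (?p / 4 + ?p / 4)"
      using pos by (intro ennreal_plus[symmetric]) auto
    finally have "?p \<le> ?p / 4 + ?p / 4"
      using pos by (subst (asm) ennreal_le_iff) auto
    then show False using pos by linarith
  qed
qed auto

end

section \<open>Paths with small Fourier tails\<close>

definition clamp01 :: "real \<Rightarrow> unit_interval" where
  "clamp01 t = unit_of_real (max 0 (min 1 t))"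

definition ext01 :: "C01 \<Rightarrow> real \<Rightarrow> real" where
  "ext01 F t = apply_bcontfun F (clamp01 t)"

lemma continuous_on_clamp01: "continuous_on UNIV clamp01"
proof -
  have "dist (clamp01 x) (clamp01 y) \<le> dist x y" for x y
    by (auto simp: clamp01_def dist_unit_interval_def unit_of_real_inverse dist_real_def)
  then show ?thesis
    unfolding continuous_on_iff by (meson le_less_trans)
qed

lemma clamp01_real_of_unit [simp]: "clamp01 (real_of_unit x) = x"
  using real_of_unit[of x] by (simp add: clamp01_def real_of_unit_inverse)

lemma real_of_unit_clamp01: "t \<in> {0..1} \<Longrightarrow> real_of_unit (clamp01 t) = t"
  by (simp add: clamp01_def unit_of_real_inverse)

lemma preimage01_eq: "preimage01 F V = {t \<in> {0..1}. ext01 F t \<in> V}"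
proof (intro equalityI subsetI)
  fix t assume "t \<in> preimage01 F V"
  then show "t \<in> {t \<in> {0..1}. ext01 F t \<in> V}"
    using real_of_unit by (auto simp: preimage01_def ext01_def)
next
  fix t assume "t \<in> {t \<in> {0..1}. ext01 F t \<in> V}"
  then show "t \<in> preimage01 F V"
    unfolding preimage01_def ext01_def
    by (intro image_eqI[of _ _ "clamp01 t"]) (auto simp: real_of_unit_clamp01)
qed

lemma range_apply_bcontfun_eq: "range (apply_bcontfun F) = ext01 F ` {0..1}"
proof (intro equalityI subsetI)
  fix y assume "y \<in> range (apply_bcontfun F)"
  then obtain x where "y = apply_bcontfun F x" by auto
  then have "y = ext01 F (real_of_unit x)" by (simp add: ext01_def)
  then show "y \<in> ext01 F ` {0..1}" using real_of_unit[of x] by blast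
qed (auto simp: ext01_def)

lemma continuous_on_ext01: "continuous_on UNIV (ext01 F)"
  unfolding ext01_def[abs_def]
  by (rule continuous_on_compose2[OF _ continuous_on_clamp01]) auto

lemma ext01_add [simp]: "ext01 (F + G) t = ext01 F t + ext01 G t"
  by (simp add: ext01_def)

lemma ext01_scaleR [simp]: "ext01 (c *\<^sub>R F) t = c * ext01 F t"
  by (simp add: ext01_def)

lemma norm_ext01_le: "\<bar>ext01 F t\<bar> \<le> norm F"
  using norm_bounded[of F "clamp01 t"] by (simp add: ext01_def)

lemma bounded_linear_ext01: "bounded_linear (\<lambda>F. ext01 F t)"
  by (rule bounded_linear_intro[of _ 1]) (auto simp: norm_ext01_le)

lemma dist_ext01_le: "dist (ext01 F t) (ext01 G t) \<le> dist F G"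
  unfolding ext01_def by (rule dist_bounded)

lemma ext01_measurable [measurable]: "(\<lambda>(F, t). ext01 F t) \<in> borel_measurable (borel \<Otimes>\<^sub>M borel)"
proof -
  have "isCont (\<lambda>(F, t). ext01 F t) (F0, t0)" for F0 t0
    unfolding continuous_at_eps_delta
  proof (intro allI impI)
    fix e :: real assume e: "e > 0"
    have "isCont (ext01 F0) t0"
      using continuous_on_ext01 continuous_on_eq_continuous_at open_UNIV by blast
    then obtain d where d: "d > 0" "\<And>t. dist t t0 < d \<Longrightarrow> dist (ext01 F0 t) (ext01 F0 t0) < e / 2"
      using e unfolding continuous_at_eps_delta by (meson half_gt_zero)
    show "\<exists>d>0. \<forall>x'. dist x' (F0, t0) < d \<longrightarrow> dist (case x' of (F, t) \<Rightarrow> ext01 F t) (case (F0, t0) of (F, t) \<Rightarrow> ext01 F t) < e"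
    proof (intro exI[of _ "min d (e / 2)"] conjI allI impI)
      fix x' :: "C01 \<times> real" assume x': "dist x' (F0, t0) < min d (e / 2)"
      obtain F t where [simp]: "x' = (F, t)" by (cases x')
      have "dist F F0 < e / 2" "dist t t0 < d"
        using x' dist_fst_le[of x' "(F0, t0)"] dist_snd_le[of x' "(F0, t0)"] by auto
      then show "dist (case x' of (F, t) \<Rightarrow> ext01 F t) (case (F0, t0) of (F, t) \<Rightarrow> ext01 F t) < e"
        using dist_ext01_le[of F t F0] d(2)[of t] dist_triangle[of "ext01 F t" "ext01 F0 t0" "ext01 F0 t"] by simp
    qed (use e d in auto)
  qed
  then have "continuous_on UNIV (\<lambda>(F, t). ext01 F t)"
    by (intro continuous_at_imp_continuous_on ballI) (metis surj_pair)
  then show ?thesis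
    using borel_measurable_continuous_onI borel_prod by metis
qed

definition tail_mass :: "C01 \<Rightarrow> nat \<Rightarrow> nat \<Rightarrow> ennreal" where
  "tail_mass F n j = (\<integral>\<^sup>+\<xi>. ennreal (norm (osc (window n j) (ext01 F) \<xi>)) * indicator {\<xi>. cutoff n \<le> \<bar>\<xi>\<bar>} \<xi> \<partial>lborel)"

definition total_tail :: "C01 \<Rightarrow> ennreal" where
  "total_tail F = (\<Sum>n. \<Sum>j\<le>2 ^ n. 2 ^ n * tail_mass F n j)"

lemma osc_ext01_measurable [measurable]:
  "(\<lambda>(F, \<xi>). osc (window n j) (ext01 F) \<xi>) \<in> borel_measurable (borel \<Otimes>\<^sub>M borel)"
proof -
  interpret finite_measure "window n j" by (rule finite_measure_window)
  show ?thesis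
    unfolding osc_def by measurable
qed

lemma total_tail_measurable [measurable]: "total_tail \<in> borel_measurable borel"
  unfolding total_tail_def[abs_def] tail_mass_def by measurable

lemma tame_pathI:
  assumes "total_tail F < \<infinity>"
  shows "tame_path (ext01 F) (enn2real (total_tail F))"
proof
  show "continuous_on UNIV (ext01 F)" by (rule continuous_on_ext01)
  fix n j :: nat assume j: "j \<le> 2 ^ n"
  have "2 ^ n * tail_mass F n j \<le> (\<Sum>j\<le>2 ^ n. 2 ^ n * tail_mass F n j)"
    using j by (intro member_le_sum) auto
  also have "\<dots> = (\<Sum>n\<in>{n}. \<Sum>j\<le>2 ^ n. 2 ^ n * tail_mass F n j)"
    by simp
  also have "\<dots> \<le> total_tail F"
    unfolding total_tail_def by (intro sum_le_suminf) auto
  also have "\<dots> = ennreal (enn2real (total_tail F))"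
    using assms by simp
  finally have le: "2 ^ n * tail_mass F n j \<le> ennreal (enn2real (total_tail F))" .
  have "tail_mass F n j = ennreal (1 / 2 ^ n) * (ennreal (2 ^ n) * tail_mass F n j)"
    by (simp add: mult.assoc[symmetric] flip: ennreal_mult)
  also have "\<dots> \<le> ennreal (1 / 2 ^ n) * ennreal (enn2real (total_tail F))"
    using le by (intro mult_left_mono) (auto simp flip: ennreal_power)
  also have "\<dots> = ennreal (enn2real (total_tail F) / 2 ^ n)"
    by (subst ennreal_mult[symmetric]) auto
  finally show "(\<integral>\<^sup>+\<xi>. ennreal (norm (osc (window n j) (ext01 F) \<xi>)) * indicator {\<xi>. cutoff n \<le> \<bar>\<xi>\<bar>} \<xi> \<partial>lborel)
      \<le> ennreal (enn2real (total_tail F) / 2 ^ n)"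
    by (simp add: tail_mass_def)
qed auto

lemma fibres_of_tame_path:
  assumes "total_tail F < \<infinity>"
  shows "\<exists>U :: real set. open U \<and>
           emeasure lebesgue (preimage01 F U) = 1 \<and>
           range (apply_bcontfun F) \<subseteq> closure (U \<inter> range (apply_bcontfun F)) \<and>
           (\<forall>y\<in>U. hausdorff_dim (preimage01 F {y}) = 1)"
proof -
  interpret tame_path "ext01 F" "enn2real (total_tail F)"
    by (rule tame_pathI) fact
  interpret integrable_osc "window 0 0" "ext01 F"
    by (rule integrable_osc_window) simp
  define U where "U = {y. local_time (window 0 0) (ext01 F) y > 0}"
  have "open U"
    unfolding U_def by (intro open_Collect_less continuous_local_time continuous_on_const)
  have AE: "AE t in window 0 0. ext01 F t \<in> U"
  proof -
    have "\<bar>ext01 F t\<bar> < norm F + 1" for t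
      using norm_ext01_le[of F t] by simp
    from AE_local_time_pos[OF this] show ?thesis by (simp add: U_def)
  qed
  have [measurable]: "{t. ext01 F t \<in> U} \<in> sets borel"
    using borel_open[OF \<open>open U\<close>] by measurable
  have "emeasure (window 0 0) {t. ext01 F t \<in> U} = emeasure (window 0 0) UNIV"
    using AE by (intro emeasure_eq_AE) auto
  then have mass: "emeasure lborel ({t. ext01 F t \<in> U} \<inter> {0..1}) = 1"
    by (simp add: emeasure_window_0)
  have pre: "preimage01 F U = {t. ext01 F t \<in> U} \<inter> {0..1}"
    by (auto simp: preimage01_eq)
  have leb: "emeasure lebesgue (preimage01 F U) = 1"
    unfolding pre using mass by (subst emeasure_completion) auto
  have dense: "ext01 F x \<in> closure (U \<inter> ext01 F ` {0..1})" if x: "x \<in> {0..1}" for x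
    unfolding closure_approachable
  proof (intro allI impI)
    fix e :: real assume "e > 0"
    then obtain d where d: "d > 0" "\<And>t. dist t x < d \<Longrightarrow> dist (ext01 F t) (ext01 F x) < e"
      using continuous_on_ext01[of F] unfolding continuous_on_iff by blast
    define I where "I = {max 0 (x - d / 2)..min 1 (x + d / 2)}"
    have "max 0 (x - d / 2) < min 1 (x + d / 2)"
      using x d(1) by auto
    then have "emeasure lborel I > 0"
      unfolding I_def by (subst emeasure_lborel_Icc) auto
    moreover have "I \<inter> {0..1} = I" unfolding I_def by auto
    ultimately have "emeasure (window 0 0) I \<noteq> 0"
      by (subst emeasure_window_0) (auto simp: I_def)
    moreover have "emeasure (window 0 0) I = 0" if "\<And>t. t \<in> I \<Longrightarrow> ext01 F t \<notin> U"
    proof -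
      have "AE t in window 0 0. t \<notin> I"
        using AE by eventually_elim (use that in blast)
      from emeasure_eq_0_AE[OF this] show ?thesis by simp
    qed
    ultimately obtain t where "t \<in> I" "ext01 F t \<in> U"
      by blast
    then show "\<exists>y\<in>U \<inter> ext01 F ` {0..1}. dist y (ext01 F x) < e"
      using d by (intro bexI[of _ "ext01 F t"]) (auto simp: I_def dist_real_def)
  qed
  have "hausdorff_dim (preimage01 F {y}) = 1" if "y \<in> U" for y
    using hausdorff_dim_fibre[of y] that by (simp add: U_def preimage01_eq)
  with \<open>open U\<close> leb dense show ?thesis
    unfolding range_apply_bcontfun_eq by (intro exI[of _ U]) auto
qed

section \<open>The Gaussian perturbation\<close>

lemma nn_integral_norm_char_sq_le:
  fixes X :: "'a \<Rightarrow> 'b \<Rightarrow> real"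
  assumes M: "prob_space M" and N: "finite_measure N"
    and X [measurable]: "(\<lambda>(\<omega>, t). X \<omega> t) \<in> borel_measurable (M \<Otimes>\<^sub>M N)"
  shows "(\<integral>\<^sup>+\<omega>. ennreal ((norm (CLINT t|N. iexp (X \<omega> t)))\<^sup>2) \<partial>M)
     \<le> (\<integral>\<^sup>+t. \<integral>\<^sup>+s. ennreal (norm (CLINT \<omega>|M. iexp (X \<omega> t - X \<omega> s))) \<partial>N \<partial>N)"
proof -
  interpret M: prob_space M by fact
  interpret N: finite_measure N by fact
  interpret NN: pair_sigma_finite N N ..
  interpret Q: finite_measure "N \<Otimes>\<^sub>M N"
    by (rule finite_measure_pair_measure) (fact N)+
  interpret MQ: pair_sigma_finite M "N \<Otimes>\<^sub>M N" ..
  interpret MQ': finite_measure "M \<Otimes>\<^sub>M (N \<Otimes>\<^sub>M N)"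
    by (rule finite_measure_pair_measure) unfold_locales
  have [measurable]: "X \<omega> \<in> borel_measurable N" if "\<omega> \<in> space M" for \<omega>
    using measurable_compose[OF measurable_Pair1'[OF that] X] by simp
  have [measurable]: "(\<lambda>\<omega>. X \<omega> t) \<in> borel_measurable M" if "t \<in> space N" for t
    using measurable_compose[OF measurable_Pair2'[OF that] X] by simp
  have X1 [measurable]: "(\<lambda>(\<omega>, p). X \<omega> (fst p)) \<in> borel_measurable (M \<Otimes>\<^sub>M (N \<Otimes>\<^sub>M N))"
    "(\<lambda>(\<omega>, p). X \<omega> (snd p)) \<in> borel_measurable (M \<Otimes>\<^sub>M (N \<Otimes>\<^sub>M N))"
    using measurable_compose[OF _ X, of "\<lambda>(\<omega>, p). (\<omega>, fst p)"] measurable_compose[OF _ X, of "\<lambda>(\<omega>, p). (\<omega>, snd p)"]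
    by (simp_all add: case_prod_beta')
  let ?u = "\<lambda>\<omega>. CLINT t|N. iexp (X \<omega> t)"
  let ?h = "\<lambda>\<omega> p. iexp (X \<omega> (fst p) - X \<omega> (snd p))"
  have sq: "complex_of_real ((norm (?u \<omega>))\<^sup>2) = (CLINT p|N \<Otimes>\<^sub>M N. ?h \<omega> p)" if \<omega>: "\<omega> \<in> space M" for \<omega>
  proof -
    have "integrable (N \<Otimes>\<^sub>M N) (\<lambda>(t, s). iexp (X \<omega> t - X \<omega> s))"
      using \<omega> by (intro Q.integrable_const_bound[of _ 1]) (auto simp: case_prod_beta')
    from NN.integral_fst'[OF this[unfolded case_prod_beta']]
    have "(CLINT p|N \<Otimes>\<^sub>M N. ?h \<omega> p) = (CLINT t|N. CLINT s|N. iexp (X \<omega> t - X \<omega> s))"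
      by simp
    also have "\<dots> = (CLINT t|N. CLINT s|N. iexp (X \<omega> t) * cnj (iexp (X \<omega> s)))"
      by (simp add: exp_cnj right_diff_distrib exp_diff exp_minus divide_inverse)
    also have "\<dots> = ?u \<omega> * cnj (?u \<omega>)"
      using Bochner_Integration.integral_cnj[of N "\<lambda>t. iexp (X \<omega> t)"]
      by (simp only: integral_mult_right_zero integral_mult_left_zero)
    also have "\<dots> = complex_of_real ((norm (?u \<omega>))\<^sup>2)"
      by (rule complex_norm_square[symmetric])
    finally show ?thesis by simp
  qed
  have int: "integrable (M \<Otimes>\<^sub>M (N \<Otimes>\<^sub>M N)) (\<lambda>(\<omega>, p). ?h \<omega> p)"
    using X1 by (intro MQ'.integrable_const_bound[of _ 1]) (auto simp: case_prod_beta')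
  have u_meas [measurable]: "?u \<in> borel_measurable M"
    by measurable
  have u_le: "norm (?u \<omega>) \<le> measure N (space N)" for \<omega>
    using integral_norm_bound[of N "\<lambda>t. iexp (X \<omega> t)"] by simp
  have "(\<integral>\<^sup>+\<omega>. ennreal ((norm (?u \<omega>))\<^sup>2) \<partial>M) = ennreal (LINT \<omega>|M. (norm (?u \<omega>))\<^sup>2)"
  proof (rule nn_integral_eq_integral)
    show "integrable M (\<lambda>\<omega>. (norm (?u \<omega>))\<^sup>2)"
      using u_le by (intro M.integrable_const_bound[of _ "(measure N (space N))\<^sup>2"]) (auto intro!: power_mono)
  qed auto
  also have "(LINT \<omega>|M. (norm (?u \<omega>))\<^sup>2) = norm (CLINT \<omega>|M. complex_of_real ((norm (?u \<omega>))\<^sup>2))"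
    by (simp add: integral_complex_of_real del: of_real_power)
  also have "(CLINT \<omega>|M. complex_of_real ((norm (?u \<omega>))\<^sup>2)) = (CLINT \<omega>|M. CLINT p|N \<Otimes>\<^sub>M N. ?h \<omega> p)"
    by (intro Bochner_Integration.integral_cong refl sq)
  also have "\<dots> = (CLINT p|N \<Otimes>\<^sub>M N. CLINT \<omega>|M. ?h \<omega> p)"
    using MQ.Fubini_integral[OF int] by simp
  also have "ennreal (norm \<dots>) \<le> (\<integral>\<^sup>+p. ennreal (norm (CLINT \<omega>|M. ?h \<omega> p)) \<partial>(N \<Otimes>\<^sub>M N))"
    using integrable_norm[OF MQ.integrable_snd[OF int]] integral_norm_bound_ennreal MQ.integrable_snd[OF int]
    by blast
  also have "\<dots> = (\<integral>\<^sup>+t. \<integral>\<^sup>+s. ennreal (norm (CLINT \<omega>|M. iexp (X \<omega> t - X \<omega> s))) \<partial>N \<partial>N)"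
    using X1 by (subst N.nn_integral_fst[symmetric]) (auto simp: case_prod_beta')
  finally show ?thesis by simp
qed

definition coef :: "nat \<Rightarrow> real" where
  "coef k = 1 / (real (k div 2) + 1)\<^sup>2"

definition trig :: "nat \<Rightarrow> real \<Rightarrow> real" where
  "trig k x = (if even k then cos (2 ^ (k div 2) * pi * x) else sin (2 ^ (k div 2) * pi * x))"

definition basis :: "nat \<Rightarrow> C01" where
  "basis k = Bcontfun (\<lambda>x. coef k * trig k (real_of_unit x))"

lemma coef_nonneg [simp]: "coef k \<ge> 0"
  by (simp add: coef_def)

lemma abs_trig_le: "\<bar>trig k x\<bar> \<le> 1"
  by (simp add: trig_def)

lemma basis_apply: "apply_bcontfun (basis k) x = coef k * trig k (real_of_unit x)"
proof -
  have "continuous_on UNIV real_of_unit"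
    unfolding continuous_on_iff by (auto simp: dist_unit_interval_def)
  then have "continuous_on UNIV (\<lambda>x. coef k * trig k (real_of_unit x))"
    unfolding trig_def by (cases "even k") (auto intro!: continuous_intros)
  moreover have "norm (coef k * trig k (real_of_unit x)) \<le> coef k" for x
    using abs_trig_le[of k "real_of_unit x"] by (simp add: abs_mult mult_left_le)
  ultimately have "(\<lambda>x. coef k * trig k (real_of_unit x)) \<in> bcontfun"
    by (rule bcontfun_normI)
  then show ?thesis by (simp add: basis_def Bcontfun_inverse)
qed

lemma norm_basis_le: "norm (basis k) \<le> coef k"
  using abs_trig_le by (intro norm_bound) (simp add: basis_apply abs_mult mult_left_le)

lemma ext01_basis: "t \<in> {0..1} \<Longrightarrow> ext01 (basis k) t = coef k * trig k t"
  by (simp add: ext01_def basis_apply real_of_unit_clamp01)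

lemma summable_coef: "summable coef"
proof (rule summable_comparison_test')
  show "summable (\<lambda>k. 4 * (1 / real (Suc k) ^ 2))"
    using summable_Suc_iff[of "\<lambda>k. inverse (real k ^ 2)"] inverse_power_summable[of 2, where 'a = real]
    by (intro summable_mult) (simp add: inverse_eq_divide)
  fix k :: nat assume "0 \<le> k"
  have "Suc k \<le> 2 * (k div 2 + 1)" by presburger
  then have "real (Suc k) \<le> real (2 * (k div 2 + 1))" by (rule of_nat_mono)
  then have "real (Suc k) \<le> 2 * (real (k div 2) + 1)" by simp
  then have "real (Suc k) ^ 2 \<le> (2 * (real (k div 2) + 1)) ^ 2" by (intro power_mono) auto
  also have "\<dots> = 4 * (real (k div 2) + 1) ^ 2" by (simp only: power_mult_distrib) simp
  finally show "norm (coef k) \<le> 4 * (1 / real (Suc k) ^ 2)"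
    by (simp add: coef_def field_simps del: of_nat_Suc)
qed

abbreviation gauss_seq :: "(nat \<Rightarrow> real) measure" where
  "gauss_seq \<equiv> PiM UNIV (\<lambda>_. std_normal_distribution)"

interpretation gauss_seq: prob_space gauss_seq
  by (intro prob_space_PiM prob_space_normal_density) simp

lemma coordinate_measurable [measurable]: "(\<lambda>\<omega>. \<omega> k) \<in> borel_measurable gauss_seq"
  using measurable_component_singleton[of k UNIV "\<lambda>_. std_normal_distribution"] by simp

instance bcontfun :: (metric_space, banach) banach ..

definition series :: "(nat \<Rightarrow> real) \<Rightarrow> C01" where
  "series \<omega> = (\<Sum>k. \<omega> k *\<^sub>R basis k)"

lemma series_measurable [measurable]: "series \<in> borel_measurable gauss_seq"
  unfolding series_def[abs_def] by measurable

lemma distr_coordinate: "distr gauss_seq borel (\<lambda>\<omega>. \<omega> k) = std_normal_distribution"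
proof -
  have "distr gauss_seq std_normal_distribution (\<lambda>\<omega>. \<omega> k) = std_normal_distribution"
    by (rule distr_PiM_component) (simp_all add: prob_space_normal_density)
  moreover have "distr gauss_seq borel (\<lambda>\<omega>. \<omega> k) = distr gauss_seq std_normal_distribution (\<lambda>\<omega>. \<omega> k)"
    by (rule distr_cong) auto
  ultimately show ?thesis by simp
qed

lemma AE_summable_series: "AE \<omega> in gauss_seq. summable (\<lambda>k. \<omega> k *\<^sub>R basis k)"
proof -
  define K where "K = (\<integral>\<^sup>+x. ennreal \<bar>x\<bar> \<partial>std_normal_distribution)"
  have "integrable std_normal_distribution (\<lambda>x. x)"
    using integrable_std_normal_distribution_moment[of 1] by simp
  then have K: "K < \<infinity>"
    by (simp add: K_def integrable_iff_bounded)
  have "(\<integral>\<^sup>+\<omega>. (\<Sum>k. ennreal (coef k) * ennreal \<bar>\<omega> k\<bar>) \<partial>gauss_seq)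
      = (\<Sum>k. \<integral>\<^sup>+\<omega>. ennreal (coef k) * ennreal \<bar>\<omega> k\<bar> \<partial>gauss_seq)"
    by (rule nn_integral_suminf) measurable
  also have "\<dots> = (\<Sum>k. ennreal (coef k) * K)"
  proof (intro arg_cong[where f = suminf] ext)
    fix k
    have "(\<integral>\<^sup>+\<omega>. ennreal \<bar>\<omega> k\<bar> \<partial>gauss_seq) = (\<integral>\<^sup>+x. ennreal \<bar>x\<bar> \<partial>distr gauss_seq borel (\<lambda>\<omega>. \<omega> k))"
      by (subst nn_integral_distr) auto
    also have "\<dots> = K" by (simp add: distr_coordinate K_def)
    finally show "(\<integral>\<^sup>+\<omega>. ennreal (coef k) * ennreal \<bar>\<omega> k\<bar> \<partial>gauss_seq) = ennreal (coef k) * K"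
      by (simp add: nn_integral_cmult)
  qed
  also have "\<dots> = (\<Sum>k. ennreal (coef k)) * K"
    by (rule ennreal_suminf_multc)
  also have "(\<Sum>k. ennreal (coef k)) = ennreal (\<Sum>k. coef k)"
    by (rule suminf_ennreal2) (auto simp: summable_coef)
  also have "ennreal (\<Sum>k. coef k) * K \<noteq> \<infinity>"
    using K by (simp add: ennreal_mult_eq_top_iff less_top)
  finally have "AE \<omega> in gauss_seq. (\<Sum>k. ennreal (coef k) * ennreal \<bar>\<omega> k\<bar>) \<noteq> \<infinity>"
    by (intro nn_integral_PInf_AE) auto
  then show ?thesis
  proof eventually_elim
    case (elim \<omega>)
    have "(\<Sum>k. ennreal (coef k) * ennreal \<bar>\<omega> k\<bar>) = (\<Sum>k. ennreal (coef k * \<bar>\<omega> k\<bar>))"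
      by (simp add: ennreal_mult)
    then have "summable (\<lambda>k. coef k * \<bar>\<omega> k\<bar>)"
      using elim by (intro summable_suminf_not_top) auto
    then have "summable (\<lambda>k. norm (\<omega> k *\<^sub>R basis k))"
      by (rule summable_comparison_test[rotated])
         (auto intro!: exI[of _ 0] simp: mult.commute[of "coef _"] intro: mult_left_mono norm_basis_le)
    then show ?case by (rule summable_norm_cancel)
  qed
qed

lemma indep_coordinates: "gauss_seq.indep_vars (\<lambda>_. borel) (\<lambda>k \<omega>. \<omega> k) UNIV"
proof (subst gauss_seq.indep_vars_iff_distr_eq_PiM')
  have "distr gauss_seq (PiM UNIV (\<lambda>_. borel)) (\<lambda>\<omega>. \<omega>) = gauss_seq"
    by (intro distr_id2 sets_PiM_cong refl) simp
  then show "distr gauss_seq (PiM UNIV (\<lambda>i. borel)) (\<lambda>x. \<lambda>i\<in>UNIV. x i)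
     = PiM UNIV (\<lambda>i. distr gauss_seq borel (\<lambda>\<omega>. \<omega> i))"
    by (simp add: distr_coordinate restrict_UNIV)
qed auto

lemma char_partial_sum:
  "(CLINT \<omega>|gauss_seq. iexp (\<xi> * (\<Sum>k<K. \<omega> k * d k))) = of_real (exp (- (\<Sum>k<K. (\<xi> * d k)\<^sup>2 / 2)))"
proof -
  have ind: "gauss_seq.indep_vars (\<lambda>_. borel) (\<lambda>k \<omega>. \<omega> k * d k) {..<K}"
    by (rule gauss_seq.indep_vars_compose2[OF gauss_seq.indep_vars_subset[OF indep_coordinates]]) auto
  have coord: "char (distr gauss_seq borel (\<lambda>\<omega>. \<omega> k * d k)) \<xi> = of_real (exp (- ((\<xi> * d k)\<^sup>2 / 2)))" for k
  proof -
    have "char (distr gauss_seq borel (\<lambda>\<omega>. \<omega> k * d k)) \<xi> = char (distr gauss_seq borel (\<lambda>\<omega>. \<omega> k)) (\<xi> * d k)"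
      unfolding char_def by (simp add: integral_distr mult_ac)
    then show ?thesis
      by (simp add: distr_coordinate char_std_normal_distribution)
  qed
  have "(CLINT \<omega>|gauss_seq. iexp (\<xi> * (\<Sum>k<K. \<omega> k * d k)))
      = char (distr gauss_seq borel (\<lambda>\<omega>. \<Sum>k<K. \<omega> k * d k)) \<xi>"
    unfolding char_def by (subst integral_distr) auto
  also have "\<dots> = (\<Prod>k<K. of_real (exp (- ((\<xi> * d k)\<^sup>2 / 2))))"
    using gauss_seq.char_distr_sum[OF ind] by (simp only: coord)
  also have "\<dots> = of_real (exp (- (\<Sum>k<K. (\<xi> * d k)\<^sup>2 / 2)))"
    by (simp add: exp_sum flip: sum_negf of_real_prod)
  finally show ?thesis .
qed

lemma norm_char_increment_le:
  fixes t s \<xi> :: real and m :: nat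
  defines "d \<equiv> \<lambda>k. ext01 (basis k) t - ext01 (basis k) s"
  shows "norm (CLINT \<omega>|gauss_seq. iexp (\<xi> * (ext01 (series \<omega>) t - ext01 (series \<omega>) s)))
      \<le> exp (- (\<xi>\<^sup>2 * ((d (2 * m))\<^sup>2 + (d (2 * m + 1))\<^sup>2) / 2))"
proof -
  have [measurable]: "(\<lambda>F. ext01 F u) \<in> borel_measurable borel" for u
    using measurable_compose[OF measurable_Pair2'[of u borel borel] ext01_measurable] by simp
  have "(\<lambda>K. CLINT \<omega>|gauss_seq. iexp (\<xi> * (\<Sum>k<K. \<omega> k * d k)))
     \<longlonglongrightarrow> (CLINT \<omega>|gauss_seq. iexp (\<xi> * (ext01 (series \<omega>) t - ext01 (series \<omega>) s)))"
  proof (rule integral_dominated_convergence[where w = "\<lambda>_. 1"])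
    show "AE \<omega> in gauss_seq. (\<lambda>K. iexp (\<xi> * (\<Sum>k<K. \<omega> k * d k)))
        \<longlonglongrightarrow> iexp (\<xi> * (ext01 (series \<omega>) t - ext01 (series \<omega>) s))"
      using AE_summable_series
    proof eventually_elim
      case (elim \<omega>)
      then have "(\<lambda>k. \<omega> k *\<^sub>R basis k) sums series \<omega>"
        unfolding series_def by (rule summable_sums)
      from bounded_linear.sums[OF bounded_linear_sub[OF bounded_linear_ext01 bounded_linear_ext01] this]
      have "(\<lambda>k. \<omega> k * d k) sums (ext01 (series \<omega>) t - ext01 (series \<omega>) s)"
        by (simp add: d_def right_diff_distrib)
      then show ?case
        unfolding sums_def by (intro tendsto_intros)
    qed
  qed auto
  then have lim: "(\<lambda>K. norm (CLINT \<omega>|gauss_seq. iexp (\<xi> * (\<Sum>k<K. \<omega> k * d k))))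
     \<longlonglongrightarrow> norm (CLINT \<omega>|gauss_seq. iexp (\<xi> * (ext01 (series \<omega>) t - ext01 (series \<omega>) s)))"
    by (rule tendsto_norm)
  have "norm (CLINT \<omega>|gauss_seq. iexp (\<xi> * (\<Sum>k<K. \<omega> k * d k)))
      \<le> exp (- (\<xi>\<^sup>2 * ((d (2 * m))\<^sup>2 + (d (2 * m + 1))\<^sup>2) / 2))" if K: "K \<ge> 2 * m + 2" for K
  proof -
    have "\<xi>\<^sup>2 * ((d (2 * m))\<^sup>2 + (d (2 * m + 1))\<^sup>2) / 2 = (\<Sum>k\<in>{2 * m, 2 * m + 1}. (\<xi> * d k)\<^sup>2 / 2)"
      by (simp add: power_mult_distrib algebra_simps add_divide_distrib)
    also have "\<dots> \<le> (\<Sum>k<K. (\<xi> * d k)\<^sup>2 / 2)"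
      using K by (intro sum_mono2) auto
    finally show ?thesis
      unfolding char_partial_sum by simp
  qed
  then show ?thesis
    by (intro LIMSEQ_le_const2[OF lim]) blast
qed

text \<open>
  The angle \<open>2\<^sup>m \<pi> (t - s)\<close> lies between \<open>\<pi> / 2\<close> and \<open>\<pi>\<close> in absolute value, so the corresponding chord of
  the unit circle has length at least \<open>sqrt 2\<close>.
\<close>

lemma trig_increment_ge:
  assumes "1 / 2 ^ Suc m < \<bar>t - s\<bar>" "\<bar>t - s\<bar> \<le> 1 / 2 ^ m"
  shows "(trig (2 * m) t - trig (2 * m) s)\<^sup>2 + (trig (2 * m + 1) t - trig (2 * m + 1) s)\<^sup>2 \<ge> 2"
proof -
  define a b where "a = 2 ^ m * pi * t" and "b = 2 ^ m * pi * s"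
  have "(cos a - cos b)\<^sup>2 + (sin a - sin b)\<^sup>2 = ((cos a)\<^sup>2 + (sin a)\<^sup>2) + ((cos b)\<^sup>2 + (sin b)\<^sup>2) - 2 * cos (a - b)"
    by (simp add: cos_diff power2_eq_square algebra_simps)
  also have "\<dots> = 2 - 2 * cos (a - b)"
    by simp
  finally have eq: "(cos a - cos b)\<^sup>2 + (sin a - sin b)\<^sup>2 = 2 - 2 * cos (a - b)" .
  have ab: "\<bar>a - b\<bar> = pi * (2 ^ m * \<bar>t - s\<bar>)"
    by (simp add: a_def b_def abs_mult flip: right_diff_distrib)
  have "1 / 2 \<le> 2 ^ m * \<bar>t - s\<bar>" "2 ^ m * \<bar>t - s\<bar> \<le> 1"
    using assms by (simp_all add: field_simps)
  then have "pi * (1 / 2) \<le> \<bar>a - b\<bar>" "\<bar>a - b\<bar> \<le> pi * 1"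
    unfolding ab by (intro mult_left_mono; simp)+
  then have "cos \<bar>a - b\<bar> \<le> cos (pi / 2)"
    by (intro cos_monotone_0_pi_le) auto
  then have "cos (a - b) \<le> 0" by simp
  with eq show ?thesis by (simp add: trig_def a_def b_def)
qed

lemma dyadic_scale:
  fixes x :: real
  assumes "1 / 2 ^ q < x" "x \<le> 1"
  obtains m where "m < q" "1 / 2 ^ Suc m < x" "x \<le> 1 / 2 ^ m"
proof -
  obtain l where l: "1 / 2 ^ l < x" "\<And>k. k < l \<Longrightarrow> \<not> 1 / 2 ^ k < x"
    using exists_least_iff[of "\<lambda>l. 1 / 2 ^ l < x"] assms(1) by blast
  obtain m where m: "l = Suc m"
    using l(1) assms(2) by (cases l) auto
  have "l \<le> q" using l(2)[of q] assms(1) by (meson not_le)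
  then show ?thesis using that[of m] l m by (auto simp: not_less)
qed

lemma norm_char_far_le:
  assumes t: "t \<in> {0..1}" and s: "s \<in> {0..1}" and far: "1 / 2 ^ q < \<bar>t - s\<bar>" and \<xi>: "real q ^ 3 \<le> \<bar>\<xi>\<bar>"
  shows "norm (CLINT \<omega>|gauss_seq. iexp (\<xi> * (ext01 (series \<omega>) t - ext01 (series \<omega>) s))) \<le> 1 / 2 ^ q"
proof -
  have "\<bar>t - s\<bar> \<le> 1" using t s by auto
  then obtain m where m: "m < q" "1 / 2 ^ Suc m < \<bar>t - s\<bar>" "\<bar>t - s\<bar> \<le> 1 / 2 ^ m"
    using dyadic_scale[OF far] by metis
  define d where "d k = ext01 (basis k) t - ext01 (basis k) s" for k
  have d: "d k = coef k * (trig k t - trig k s)" for k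
    using t s by (simp add: d_def ext01_basis right_diff_distrib)
  have c: "coef (2 * m) = 1 / (real m + 1)\<^sup>2" "coef (2 * m + 1) = 1 / (real m + 1)\<^sup>2"
    by (simp_all add: coef_def)
  have "(1 / (real m + 1)\<^sup>2)\<^sup>2 * 2 \<le> (1 / (real m + 1)\<^sup>2)\<^sup>2 *
      ((trig (2 * m) t - trig (2 * m) s)\<^sup>2 + (trig (2 * m + 1) t - trig (2 * m + 1) s)\<^sup>2)"
    by (intro mult_left_mono trig_increment_ge m) auto
  also have "\<dots> = (d (2 * m))\<^sup>2 + (d (2 * m + 1))\<^sup>2"
    unfolding d c by (simp only: power_mult_distrib distrib_left)
  finally have d2: "2 / (real m + 1) ^ 4 \<le> (d (2 * m))\<^sup>2 + (d (2 * m + 1))\<^sup>2"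
    by (simp add: power_divide flip: power_mult)
  have "real q ^ 2 * (real m + 1) ^ 4 \<le> real q ^ 2 * real q ^ 4"
    using m(1) by (intro mult_left_mono power_mono) auto
  also have "\<dots> = (real q ^ 3)\<^sup>2" by (simp flip: power_add power_mult)
  also have "\<dots> \<le> \<xi>\<^sup>2" using \<xi> by (metis abs_ge_zero abs_le_square_iff abs_of_nat power_abs)
  finally have "real q ^ 2 \<le> \<xi>\<^sup>2 * (2 / (real m + 1) ^ 4) / 2"
    by (simp add: pos_le_divide_eq)
  also have "\<dots> \<le> \<xi>\<^sup>2 * ((d (2 * m))\<^sup>2 + (d (2 * m + 1))\<^sup>2) / 2"
    by (intro divide_right_mono mult_left_mono d2) auto
  finally have "real q ^ 2 \<le> \<xi>\<^sup>2 * ((d (2 * m))\<^sup>2 + (d (2 * m + 1))\<^sup>2) / 2" .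
  moreover have "real q \<le> real q ^ 2"
    using m(1) by (intro self_le_power) auto
  ultimately have "real q \<le> \<xi>\<^sup>2 * ((d (2 * m))\<^sup>2 + (d (2 * m + 1))\<^sup>2) / 2"
    by linarith
  then have "exp (- (\<xi>\<^sup>2 * ((d (2 * m))\<^sup>2 + (d (2 * m + 1))\<^sup>2) / 2)) \<le> exp (- real q)"
    by simp
  also have "exp (- real q) = 1 / exp 1 ^ q"
    by (simp add: exp_minus divide_inverse flip: exp_of_nat_mult)
  also have "\<dots> \<le> 1 / 2 ^ q"
    using exp_ge_add_one_self[of 1] by (intro divide_left_mono power_mono) auto
  finally have "exp (- (\<xi>\<^sup>2 * ((d (2 * m))\<^sup>2 + (d (2 * m + 1))\<^sup>2) / 2)) \<le> 1 / 2 ^ q" .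
  moreover have "norm (CLINT \<omega>|gauss_seq. iexp (\<xi> * (ext01 (series \<omega>) t - ext01 (series \<omega>) s)))
      \<le> exp (- (\<xi>\<^sup>2 * ((d (2 * m))\<^sup>2 + (d (2 * m + 1))\<^sup>2) / 2))"
    unfolding d_def by (rule norm_char_increment_le)
  ultimately show ?thesis by linarith
qed

lemma AE_window: "AE t in window n j. t \<in> {0..1}"
  unfolding window_def by (subst AE_density) (auto split: split_indicator)

lemma emeasure_window_near_le:
  assumes "r \<ge> 0"
  shows "emeasure (window n j) {t. \<bar>t - s\<bar> \<le> r} \<le> ennreal (2 * r)"
proof -
  have "{t. \<bar>t - s\<bar> \<le> r} = {s - r..s + r}" by auto
  moreover have "emeasure (window n j) {s - r..s + r} \<le> emeasure lborel {s - r..s + r}"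
    by (subst emeasure_window) (auto intro!: emeasure_mono simp del: emeasure_lborel_Icc_eq emeasure_lborel_Icc)
  ultimately show ?thesis using assms by simp
qed

lemma nn_integral_osc_sq_le:
  assumes \<xi>: "real q ^ 3 \<le> \<bar>\<xi>\<bar>"
  shows "(\<integral>\<^sup>+\<omega>. ennreal ((norm (osc (window n j) (ext01 (F + series \<omega>)) \<xi>))\<^sup>2) \<partial>gauss_seq) \<le> ennreal (3 / 2 ^ q)"
proof -
  let ?N = "window n j"
  let ?inc = "\<lambda>t s. CLINT \<omega>|gauss_seq. iexp (\<xi> * (ext01 (series \<omega>) t - ext01 (series \<omega>) s))"
  interpret N: finite_measure ?N by (rule finite_measure_window)
  have norm_eq: "norm (CLINT \<omega>|gauss_seq. iexp (\<xi> * ext01 (F + series \<omega>) t - \<xi> * ext01 (F + series \<omega>) s)) = norm (?inc t s)" for t s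
  proof -
    have "iexp (\<xi> * ext01 (F + series \<omega>) t - \<xi> * ext01 (F + series \<omega>) s) =
        iexp (\<xi> * (ext01 F t - ext01 F s)) * iexp (\<xi> * (ext01 (series \<omega>) t - ext01 (series \<omega>) s))" for \<omega>
      by (simp add: algebra_simps flip: exp_add)
    then show ?thesis
      by (simp only: integral_mult_right_zero norm_mult norm_exp_i_times mult_1)
  qed
  have "(\<integral>\<^sup>+\<omega>. ennreal ((norm (osc ?N (ext01 (F + series \<omega>)) \<xi>))\<^sup>2) \<partial>gauss_seq)
     \<le> (\<integral>\<^sup>+t. \<integral>\<^sup>+s. ennreal (norm (CLINT \<omega>|gauss_seq. iexp (\<xi> * ext01 (F + series \<omega>) t - \<xi> * ext01 (F + series \<omega>) s))) \<partial>?N \<partial>?N)"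
    unfolding osc_def
    by (rule nn_integral_norm_char_sq_le) (unfold_locales, measurable)
  also have "\<dots> = (\<integral>\<^sup>+t. \<integral>\<^sup>+s. ennreal (norm (?inc t s)) \<partial>?N \<partial>?N)"
    by (simp only: norm_eq)
  also have "\<dots> \<le> (\<integral>\<^sup>+t. ennreal (3 / 2 ^ q) \<partial>?N)"
  proof (rule nn_integral_mono_AE)
    show "AE t in ?N. (\<integral>\<^sup>+s. ennreal (norm (?inc t s)) \<partial>?N) \<le> ennreal (3 / 2 ^ q)"
      using AE_window[of n j]
    proof eventually_elim
      case (elim t)
      have near_borel: "{s. \<bar>s - t\<bar> \<le> 1 / 2 ^ q} \<in> sets borel"
        by measurable
      have inc_le_1: "norm (?inc t s) \<le> 1" for s
        using integral_norm_bound[of gauss_seq "\<lambda>\<omega>. iexp (\<xi> * (ext01 (series \<omega>) t - ext01 (series \<omega>) s))"]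
        by (simp add: gauss_seq.prob_space)
      have inc_far: "norm (?inc t s) \<le> 1 / 2 ^ q" if "s \<in> {0..1}" "\<not> \<bar>s - t\<bar> \<le> 1 / 2 ^ q" for s
        using that by (intro norm_char_far_le elim \<xi>) (auto simp: abs_minus_commute)
      have "AE s in ?N. ennreal (norm (?inc t s)) \<le> indicator {s. \<bar>s - t\<bar> \<le> 1 / 2 ^ q} s + ennreal (1 / 2 ^ q)"
        using AE_window[of n j]
      proof eventually_elim
        case (elim s)
        show ?case
        proof (cases "\<bar>s - t\<bar> \<le> 1 / 2 ^ q")
          case True
          then show ?thesis
            using inc_le_1[of s] by (simp add: add_increasing2)
        next
          case False
          then show ?thesis
            using inc_far[OF elim] by (simp add: ennreal_leI)
        qed
      qed
      then have "(\<integral>\<^sup>+s. ennreal (norm (?inc t s)) \<partial>?N)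
          \<le> (\<integral>\<^sup>+s. indicator {s. \<bar>s - t\<bar> \<le> 1 / 2 ^ q} s + ennreal (1 / 2 ^ q) \<partial>?N)"
        by (rule nn_integral_mono_AE)
      also have "\<dots> = emeasure ?N {s. \<bar>s - t\<bar> \<le> 1 / 2 ^ q} + ennreal (1 / 2 ^ q) * emeasure ?N UNIV"
        by (subst nn_integral_add) (auto intro!: borel_measurable_indicator near_borel)
      also have "\<dots> \<le> ennreal (2 * (1 / 2 ^ q)) + ennreal (1 / 2 ^ q) * 1"
        by (intro add_mono mult_left_mono emeasure_window_near_le emeasure_space_window_le_1) auto
      also have "\<dots> = ennreal (3 / 2 ^ q)"
        by (simp flip: ennreal_plus)
      finally show ?case .
    qed
  qed
  also have "\<dots> = ennreal (3 / 2 ^ q) * emeasure ?N UNIV" by simp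
  also have "\<dots> \<le> ennreal (3 / 2 ^ q) * 1"
    by (intro mult_left_mono emeasure_space_window_le_1) auto
  finally show ?thesis by simp
qed

lemma osc_series_measurable [measurable]:
  "(\<lambda>(\<omega>, \<xi>). osc (window n j) (ext01 (F + series \<omega>)) \<xi>) \<in> borel_measurable (gauss_seq \<Otimes>\<^sub>M borel)"
proof -
  have "(\<lambda>(\<omega>, \<xi>). (F + series \<omega>, \<xi>)) \<in> gauss_seq \<Otimes>\<^sub>M borel \<rightarrow>\<^sub>M borel \<Otimes>\<^sub>M borel"
    by measurable
  from measurable_compose[OF this osc_ext01_measurable] show ?thesis
    by (simp add: case_prod_beta')
qed

lemma nn_integral_osc_le_geometric:
  assumes \<xi>: "(2 * real p) ^ 3 \<le> \<bar>\<xi>\<bar>"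
  shows "(\<integral>\<^sup>+\<omega>. ennreal (norm (osc (window n j) (ext01 (F + series \<omega>)) \<xi>)) \<partial>gauss_seq) \<le> ennreal (2 / 2 ^ p)"
proof -
  let ?u = "\<lambda>\<omega>. norm (osc (window n j) (ext01 (F + series \<omega>)) \<xi>)"
  have [measurable]: "?u \<in> borel_measurable gauss_seq"
    using measurable_compose[OF measurable_Pair2'[of \<xi> borel gauss_seq] osc_series_measurable] by simp
  have sq: "(\<integral>\<^sup>+\<omega>. ennreal ((?u \<omega>)\<^sup>2) \<partial>gauss_seq) \<le> ennreal (3 / 2 ^ (2 * p))"
    using \<xi> by (intro nn_integral_osc_sq_le) simp
  \<comment> \<open>AM-GM with weight \<open>2\<^sup>p\<close>\<close>
  have "ennreal (?u \<omega>) \<le> ennreal (2 ^ p / 2) * ennreal ((?u \<omega>)\<^sup>2) + ennreal (1 / 2 ^ p / 2)" for \<omega>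
  proof -
    have "0 \<le> (2 ^ p * ?u \<omega> - 1)\<^sup>2 / (2 * 2 ^ p)" by simp
    also have "\<dots> = 2 ^ p / 2 * (?u \<omega>)\<^sup>2 + 1 / 2 ^ p / 2 - ?u \<omega>"
      by (simp add: power2_diff power_mult_distrib field_simps power2_eq_square)
    finally have "?u \<omega> \<le> 2 ^ p / 2 * (?u \<omega>)\<^sup>2 + 1 / 2 ^ p / 2" by simp
    then show ?thesis by (simp add: ennreal_leI flip: ennreal_mult ennreal_plus)
  qed
  then have "(\<integral>\<^sup>+\<omega>. ennreal (?u \<omega>) \<partial>gauss_seq)
     \<le> (\<integral>\<^sup>+\<omega>. ennreal (2 ^ p / 2) * ennreal ((?u \<omega>)\<^sup>2) + ennreal (1 / 2 ^ p / 2) \<partial>gauss_seq)"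
    by (intro nn_integral_mono)
  also have "\<dots> = ennreal (2 ^ p / 2) * (\<integral>\<^sup>+\<omega>. ennreal ((?u \<omega>)\<^sup>2) \<partial>gauss_seq) + ennreal (1 / 2 ^ p / 2)"
    by (subst nn_integral_add) (auto simp: nn_integral_cmult gauss_seq.emeasure_space_1)
  also have "\<dots> \<le> ennreal (2 ^ p / 2) * ennreal (3 / 2 ^ (2 * p)) + ennreal (1 / 2 ^ p / 2)"
    by (intro add_right_mono mult_left_mono sq) auto
  also have "\<dots> = ennreal (2 ^ p / 2 * (3 / 2 ^ (2 * p)) + 1 / 2 ^ p / 2)"
    by (subst ennreal_plus, simp, simp, subst ennreal_mult) auto
  also have "2 ^ p / 2 * (3 / 2 ^ (2 * p)) + 1 / 2 ^ p / 2 = (2 / 2 ^ p :: real)"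
  proof -
    have "X / 2 * (3 / (X * X)) + 1 / X / 2 = 2 / X" if "X > 0" for X :: real
      using that by (simp add: field_simps)
    from this[of "2 ^ p"] show ?thesis by (simp only: mult_2 power_add zero_less_power zero_less_numeral)
  qed
  finally show ?thesis .
qed

lemma nn_integral_inverse_1_plus_square_finite:
  "(\<integral>\<^sup>+(x::real). ennreal (1 / (1 + x\<^sup>2)) \<partial>lborel) < \<infinity>"
proof -
  let ?f = "\<lambda>x::real. 1 / (1 + x\<^sup>2)"
  have half: "(\<integral>\<^sup>+x. ennreal (?f x) * indicator {0..} x \<partial>lborel) = ennreal (pi / 2 - arctan 0)"
  proof (rule nn_integral_FTC_atLeast)
    show "DERIV arctan x :> ?f x" for x
      using DERIV_arctan[of x] by (simp add: inverse_eq_divide)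
    show "(arctan \<longlongrightarrow> pi / 2) at_top" by (rule tendsto_arctan_at_top)
  qed auto
  have "(\<integral>\<^sup>+x. ennreal (?f x) \<partial>lborel)
     \<le> (\<integral>\<^sup>+x. ennreal (?f x) * indicator {0..} x + ennreal (?f x) * indicator {0..} (- x) \<partial>lborel)"
    by (intro nn_integral_mono) (auto simp: indicator_def)
  also have "\<dots> = (\<integral>\<^sup>+x. ennreal (?f x) * indicator {0..} x \<partial>lborel) + (\<integral>\<^sup>+x. ennreal (?f x) * indicator {0..} (- x) \<partial>lborel)"
    by (rule nn_integral_add) auto
  also have "(\<integral>\<^sup>+x. ennreal (?f x) * indicator {0..} (- x) \<partial>lborel) = (\<integral>\<^sup>+x. ennreal (?f x) * indicator {0..} x \<partial>lborel)"
    using nn_integral_real_affine[of "\<lambda>x. ennreal (?f x) * indicator {0..} x" "-1" 0] by simp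
  finally show ?thesis unfolding half by (auto intro: le_less_trans)
qed

lemma nn_integral_osc_beyond_cutoff:
  obtains K where "K \<ge> 0" "\<And>F n j \<xi>. cutoff n \<le> \<bar>\<xi>\<bar> \<Longrightarrow>
    (\<integral>\<^sup>+\<omega>. ennreal (norm (osc (window n j) (ext01 (F + series \<omega>)) \<xi>)) \<partial>gauss_seq)
      \<le> ennreal (K / 8 ^ n * (1 / (1 + \<xi>\<^sup>2)))"
proof -
  define r :: real where "r = 1 / sqrt 2"
  have r: "0 < r" "r < 1" "r\<^sup>2 = 1 / 2"
    by (auto simp: r_def power_divide)
  have "(\<lambda>p. (1 + (2 * real p + 2) ^ 6) * r ^ p) \<longlonglongrightarrow> 0"
    using r(1,2) by real_asymp
  then obtain C where C: "C > 0" "\<And>p. norm ((1 + (2 * real p + 2) ^ 6) * r ^ p) \<le> C"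
    by (meson convergent_imp_Bseq convergentI BseqE)
  show ?thesis
  proof (rule that[of "2 * C"])
    show "0 \<le> 2 * C" using C by simp
    fix F n j and \<xi> :: real assume \<xi>: "cutoff n \<le> \<bar>\<xi>\<bar>"
    have "\<exists>p. \<bar>\<xi>\<bar> < (2 * real p) ^ 3"
    proof -
      obtain p :: nat where "\<bar>\<xi>\<bar> < real p" using reals_Archimedean2 by blast
      moreover have "1 \<le> 2 * real p" using \<open>\<bar>\<xi>\<bar> < real p\<close> by (cases p) auto
      then have "2 * real p \<le> (2 * real p) ^ 3" by (rule self_le_power) simp
      ultimately show ?thesis by (intro exI[of _ p]) linarith
    qed
    then obtain p' where p': "\<bar>\<xi>\<bar> < (2 * real p') ^ 3" "\<And>k. k < p' \<Longrightarrow> \<not> \<bar>\<xi>\<bar> < (2 * real k) ^ 3"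
      using exists_least_iff[of "\<lambda>p. \<bar>\<xi>\<bar> < (2 * real p) ^ 3"] by blast
    obtain p where p: "p' = Suc p" using p'(1) by (cases p') auto
    have lo: "(2 * real p) ^ 3 \<le> \<bar>\<xi>\<bar>" using p'(2)[of p] p by simp
    have hi: "\<bar>\<xi>\<bar> < (2 * real p + 2) ^ 3" using p'(1) p by (simp add: algebra_simps)
    have "(12 * real n) ^ 3 < (2 * real p + 2) ^ 3"
      using \<xi> hi by (simp add: cutoff_def)
    then have "12 * real n < 2 * real p + 2"
      by (rule power_less_imp_less_base) simp
    then have np: "6 * n \<le> p" by linarith
    have "2 / 2 ^ p = 2 * (r ^ p * r ^ p)"
    proof -
      have "r ^ p * r ^ p = (r\<^sup>2) ^ p" by (simp only: power2_eq_square power_mult_distrib)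
      then show ?thesis by (simp add: r(3) power_divide)
    qed
    also have "\<dots> \<le> 2 * (r ^ (6 * n) * (C / (1 + \<xi>\<^sup>2)))"
    proof (intro mult_left_mono mult_mono)
      show "r ^ p \<le> r ^ (6 * n)" using np r by (intro power_decreasing) auto
      have "\<xi>\<^sup>2 \<le> ((2 * real p + 2) ^ 3)\<^sup>2"
        using hi by (intro power2_le_iff_abs_le[THEN iffD2]) auto
      then have "(1 + \<xi>\<^sup>2) * r ^ p \<le> (1 + (2 * real p + 2) ^ 6) * r ^ p"
        using r by (intro mult_right_mono) (auto simp flip: power_mult)
      also have "\<dots> \<le> C" using C(2)[of p] by (simp add: abs_le_iff)
      finally show "r ^ p \<le> C / (1 + \<xi>\<^sup>2)"
        by (subst pos_le_divide_eq) (auto simp: mult.commute add_pos_nonneg)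
    qed (use r in auto)
    also have "r ^ (6 * n) = 1 / 8 ^ n"
    proof -
      have "r ^ 6 = (r\<^sup>2) ^ 3" by (simp flip: power_mult)
      also have "\<dots> = 1 / 8" unfolding r(3) by (simp add: power_divide)
      finally show ?thesis by (simp only: power_mult) (simp add: power_divide)
    qed
    finally have "2 / 2 ^ p \<le> 2 * C / 8 ^ n * (1 / (1 + \<xi>\<^sup>2))" by simp
    then show "(\<integral>\<^sup>+\<omega>. ennreal (norm (osc (window n j) (ext01 (F + series \<omega>)) \<xi>)) \<partial>gauss_seq)
      \<le> ennreal (2 * C / 8 ^ n * (1 / (1 + \<xi>\<^sup>2)))"
      using nn_integral_osc_le_geometric[OF lo] ennreal_leI order_trans by blast
  qed
qed

lemma AE_total_tail_finite: "AE \<omega> in gauss_seq. total_tail (F + series \<omega>) < \<infinity>"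
proof -
  obtain K where K: "K \<ge> 0" "\<And>n j \<xi>. cutoff n \<le> \<bar>\<xi>\<bar> \<Longrightarrow>
    (\<integral>\<^sup>+\<omega>. ennreal (norm (osc (window n j) (ext01 (F + series \<omega>)) \<xi>)) \<partial>gauss_seq)
      \<le> ennreal (K / 8 ^ n * (1 / (1 + \<xi>\<^sup>2)))"
    using nn_integral_osc_beyond_cutoff by metis
  define C where "C = enn2real (\<integral>\<^sup>+(x::real). ennreal (1 / (1 + x\<^sup>2)) \<partial>lborel)"
  have C: "(\<integral>\<^sup>+(x::real). ennreal (1 / (1 + x\<^sup>2)) \<partial>lborel) = ennreal C" "C \<ge> 0"
    using nn_integral_inverse_1_plus_square_finite by (auto simp: C_def)
  interpret P: pair_sigma_finite gauss_seq lborel ..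
  have [measurable]: "(\<lambda>\<omega>. tail_mass (F + series \<omega>) n j) \<in> borel_measurable gauss_seq" for n j
    unfolding tail_mass_def by measurable
  have tail: "(\<integral>\<^sup>+\<omega>. tail_mass (F + series \<omega>) n j \<partial>gauss_seq) \<le> ennreal (K * C / 8 ^ n)" for n j
  proof -
    let ?u = "\<lambda>\<omega> \<xi>. ennreal (norm (osc (window n j) (ext01 (F + series \<omega>)) \<xi>))"
    have "(\<integral>\<^sup>+\<omega>. tail_mass (F + series \<omega>) n j \<partial>gauss_seq)
       = (\<integral>\<^sup>+\<xi>. \<integral>\<^sup>+\<omega>. ?u \<omega> \<xi> * indicator {\<xi>. cutoff n \<le> \<bar>\<xi>\<bar>} \<xi> \<partial>gauss_seq \<partial>lborel)"
      unfolding tail_mass_def by (rule P.Fubini'[symmetric]) measurable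
    also have "\<dots> \<le> (\<integral>\<^sup>+\<xi>. ennreal (K / 8 ^ n) * ennreal (1 / (1 + \<xi>\<^sup>2)) \<partial>lborel)"
    proof (rule nn_integral_mono)
      fix \<xi> :: real
      show "(\<integral>\<^sup>+\<omega>. ?u \<omega> \<xi> * indicator {\<xi>. cutoff n \<le> \<bar>\<xi>\<bar>} \<xi> \<partial>gauss_seq) \<le> ennreal (K / 8 ^ n) * ennreal (1 / (1 + \<xi>\<^sup>2))"
      proof (cases "cutoff n \<le> \<bar>\<xi>\<bar>")
        case True
        have "ennreal (K / 8 ^ n * (1 / (1 + \<xi>\<^sup>2))) = ennreal (K / 8 ^ n) * ennreal (1 / (1 + \<xi>\<^sup>2))"
          using K(1) by (intro ennreal_mult) auto
        with True K(2)[OF True, of j] show ?thesis by simp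
      qed simp
    qed
    also have "\<dots> = ennreal (K / 8 ^ n) * ennreal C"
      by (subst nn_integral_cmult) (auto simp: C)
    also have "\<dots> = ennreal (K * C / 8 ^ n)"
      using K(1) C(2) by (simp flip: ennreal_mult)
    finally show ?thesis .
  qed
  have "(\<integral>\<^sup>+\<omega>. total_tail (F + series \<omega>) \<partial>gauss_seq)
     = (\<Sum>n. \<Sum>j\<le>2 ^ n. 2 ^ n * (\<integral>\<^sup>+\<omega>. tail_mass (F + series \<omega>) n j \<partial>gauss_seq))"
    unfolding total_tail_def by (simp add: nn_integral_suminf nn_integral_sum nn_integral_cmult)
  also have "\<dots> \<le> (\<Sum>n. ennreal (2 * K * C * (1 / 2) ^ n))"
  proof (rule suminf_le)
    fix n
    have "(\<Sum>j\<le>2 ^ n. 2 ^ n * (\<integral>\<^sup>+\<omega>. tail_mass (F + series \<omega>) n j \<partial>gauss_seq))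
       \<le> (\<Sum>j\<le>(2::nat) ^ n. ennreal (2 ^ n) * ennreal (K * C / 8 ^ n))"
      by (intro sum_mono mult_mono tail) (auto simp: ennreal_power[symmetric])
    also have "\<dots> = (\<Sum>j\<le>(2::nat) ^ n. ennreal (2 ^ n * (K * C / 8 ^ n)))"
      using K(1) C(2) by (intro sum.cong refl ennreal_mult[symmetric]) auto
    also have "\<dots> = ennreal ((2 ^ n + 1) * (2 ^ n * (K * C / 8 ^ n)))"
      using K(1) C(2) by (subst sum_ennreal) (auto simp: algebra_simps)
    also have "\<dots> \<le> ennreal (2 * K * C * (1 / 2) ^ n)"
    proof (rule ennreal_leI)
      have "(2 ^ n + 1) * (2 ^ n * (K * C / 8 ^ n)) \<le> (2 * 2 ^ n) * (2 ^ n * (K * C / 8 ^ n))"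
        using K(1) C(2) by (intro mult_right_mono) auto
      also have "\<dots> = 2 * K * C * (2 ^ n * 2 ^ n / 8 ^ n)"
        by simp
      also have "(2 ^ n * 2 ^ n / 8 ^ n :: real) = (1 / 2) ^ n"
        by (simp flip: power_mult_distrib power_divide)
      finally show "(2 ^ n + 1) * (2 ^ n * (K * C / 8 ^ n)) \<le> 2 * K * C * (1 / 2) ^ n" .
    qed
    finally show "(\<Sum>j\<le>2 ^ n. 2 ^ n * (\<integral>\<^sup>+\<omega>. tail_mass (F + series \<omega>) n j \<partial>gauss_seq)) \<le> ennreal (2 * K * C * (1 / 2) ^ n)" .
  qed auto
  also have "\<dots> = ennreal (\<Sum>n. 2 * K * C * (1 / 2) ^ n)"
    using K(1) C(2) by (intro suminf_ennreal2 summable_mult summable_geometric) auto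
  finally have "(\<integral>\<^sup>+\<omega>. total_tail (F + series \<omega>) \<partial>gauss_seq) \<noteq> \<infinity>"
    by (auto simp: top_unique)
  then have "AE \<omega> in gauss_seq. total_tail (F + series \<omega>) \<noteq> \<infinity>"
    by (intro nn_integral_PInf_AE) auto
  then show ?thesis by (simp add: less_top)
qed

theorem corollary4p2:
  shows "prevalent {f :: C01. \<exists>U :: real set. open U \<and>
           emeasure lebesgue (preimage01 f U) = 1 \<and>
           range (apply_bcontfun f) \<subseteq> closure (U \<inter> range (apply_bcontfun f)) \<and>
           (\<forall>y\<in>U. hausdorff_dim (preimage01 f {y}) = 1)}"
  (is "prevalent ?G")
proof -
  define B where "B = {f :: C01. \<not> total_tail f < \<infinity>}"
  define \<nu> where "\<nu> = distr gauss_seq borel series"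
  have B [measurable]: "B \<in> sets borel"
    unfolding B_def by measurable
  have "- ?G \<subseteq> B"
    using fibres_of_tame_path by (auto simp: B_def)
  moreover have "prob_space \<nu>"
    unfolding \<nu>_def by (rule gauss_seq.prob_space_distr) measurable
  moreover have "emeasure \<nu> ((\<lambda>b. b + x) ` B) = 0" for x
  proof -
    have eq: "(\<lambda>b. b + x) ` B = (\<lambda>f. - x + f) -` B"
      by (force simp: image_iff)
    have [measurable]: "(\<lambda>f. - x + f) -` B \<in> sets borel"
      using measurable_sets[of "\<lambda>f. - x + f" borel borel B] by simp
    have "AE \<omega> in gauss_seq. series \<omega> \<notin> (\<lambda>f. - x + f) -` B"
      using AE_total_tail_finite[of "- x"] by (simp add: B_def)
    then have "emeasure gauss_seq {\<omega> \<in> space gauss_seq. \<not> series \<omega> \<notin> (\<lambda>f. - x + f) -` B} = 0"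
      by (subst (asm) AE_iff_measurable[OF _ refl]) auto
    then show ?thesis
      unfolding eq \<nu>_def by (subst emeasure_distr) (auto simp: vimage_def Int_def conj_commute)
  qed
  ultimately show ?thesis
    unfolding prevalent_def shy_def using B by (intro exI[of _ B] exI[of _ \<nu>]) (auto simp: \<nu>_def)
qed

end
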